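(* Let $\lambda$ be a regular uncountable cardinal (i.e. $\lambda = \mathrm{cf}(\lambda) > \aleph_0$), let $\mu = 2^\lambda$, and let $\kappa = \min\{\kappa : 2^\kappa > \mu\}$. Then there is a Hausdorff topological space $X$ with a basis consisting of clopen sets such that $|X| = 2^\kappa$ and, for every closed $Y \subseteq X$, if $|Y| < |X|$ then $|Y| < \lambda$. *)

theory Defs
  imports "HOL-Analysis.Abstract_Topological_Spaces"
begin

unbundle cardinal_syntax

text \<open>
  Cardinals are cardinal orders (\<^const>\<open>Card_order\<close>) compared by the relations \<open>\<le>o\<close>, \<open><o\<close>, \<open>=o\<close>.

  \<open>least_exp_above \<mu> \<kappa>\<close> says \<open>\<kappa> = min {\<kappa>. 2\<^sup>\<kappa> > \<mu>}\<close>. The minimum can only be taken over cardinals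
  living on the type of \<open>\<kappa>\<close>, but this is no restriction: every smaller cardinal of any other type
  has a copy there. The two lemmas below make this precise and show that such a \<open>\<kappa>\<close> exists.
\<close>

definition least_exp_above :: "'m rel \<Rightarrow> 'k rel \<Rightarrow> bool" where
  "least_exp_above \<mu> \<kappa> \<longleftrightarrow>
     Card_order \<kappa> \<and> \<mu> <o ctwo ^c \<kappa> \<and>
     (\<forall>\<kappa>' :: 'k rel. Card_order \<kappa>' \<and> \<mu> <o ctwo ^c \<kappa>' \<longrightarrow> \<kappa> \<le>o \<kappa>')"

lemma least_exp_above_minimal:
  fixes \<mu> :: "'m rel" and \<kappa> :: "'k rel" and \<kappa>' :: "'c rel"
  assumes least: "least_exp_above \<mu> \<kappa>" and card: "Card_order \<kappa>'" and above: "\<mu> <o ctwo ^c \<kappa>'"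
  shows "\<kappa> \<le>o \<kappa>'"
proof (rule ccontr)
  have card_kappa: "Card_order \<kappa>"
    using least by (simp add: least_exp_above_def)
  assume neg: "\<not> \<kappa> \<le>o \<kappa>'"
  have "Well_order \<kappa>" "Well_order \<kappa>'"
    using card card_kappa by (simp_all only: card_order_on_well_order_on)
  then have "\<kappa>' \<le>o \<kappa>"
    using neg ordLeq_total by metis
  then have "|Field \<kappa>'| \<le>o |Field \<kappa>|"
    by (rule card_of_mono2)
  then obtain f :: "'c \<Rightarrow> 'k" where f: "inj_on f (Field \<kappa>')"
    unfolding card_of_ordLeq[symmetric] by auto
  define \<kappa>'' :: "'k rel" where "\<kappa>'' = |f ` Field \<kappa>'|"
  have "|Field \<kappa>'| =o \<kappa>''"
    unfolding \<kappa>''_def card_of_ordIso[symmetric] using inj_on_imp_bij_betw[OF f] by blast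
  then have iso: "\<kappa>' =o \<kappa>''"
    by (rule ordIso_transitive[OF ordIso_symmetric[OF card_of_Field_ordIso[OF card]]])
  have card'': "Card_order \<kappa>''"
    unfolding \<kappa>''_def by (rule card_of_Card_order)
  have "ctwo ^c \<kappa>' =o ctwo ^c \<kappa>''"
    by (rule cexp_cong2[OF iso Card_order_ctwo card])
  then have "\<mu> <o ctwo ^c \<kappa>''"
    by (rule ordLess_ordIso_trans[OF above])
  then have "\<kappa> \<le>o \<kappa>''"
    using least card'' by (simp add: least_exp_above_def)
  then have "\<kappa> \<le>o \<kappa>'"
    using ordIso_symmetric[OF iso] by (rule ordLeq_ordIso_trans)
  with neg show False ..
qed

lemma least_exp_above_exists:
  fixes \<mu> :: "'m rel"
  assumes "Card_order \<mu>"
  shows "\<exists>\<kappa> :: 'm rel. least_exp_above \<mu> \<kappa>"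
proof -
  let ?R = "{\<kappa> :: 'm rel. Card_order \<kappa> \<and> \<mu> <o ctwo ^c \<kappa>}"
  have "\<mu> \<in> ?R"
    using assms ordLess_ctwo_cexp by blast
  moreover have "\<forall>\<kappa> \<in> ?R. Well_order \<kappa>"
    using card_order_on_well_order_on by blast
  ultimately have "\<exists>\<kappa> \<in> ?R. \<forall>\<kappa>' \<in> ?R. \<kappa> \<le>o \<kappa>'"
    using exists_minim_Well_order[of ?R] by blast
  then show ?thesis
    unfolding least_exp_above_def by blast
qed

definition clopen_basis :: "'x topology \<Rightarrow> 'x set set \<Rightarrow> bool" where
  "clopen_basis X \<B> \<longleftrightarrow>
     (\<forall>U \<in> \<B>. openin X U \<and> closedin X U) \<and> openin X = arbitrary union_of (\<lambda>U. U \<in> \<B>)"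

end

theory Submission
  imports Defs
begin

text \<open>
  Write \<open>L\<close> and \<open>K\<close> for the fields of \<open>\<lambda>\<close> and \<open>\<kappa>\<close>. Only \<open>\<lambda> \<le> \<kappa> \<le> 2\<^sup>\<lambda>\<close> matters. The space is \<open>\<nat> \<times> P\<close> with
  \<open>P = Pow K\<close>: every injection \<open>e : L \<rightarrow> P\<close> is attached to \<open>2\<^sup>\<kappa>\<close> many points \<open>y \<in> P\<close>, and \<open>(n + 1, y)\<close> is made
  the limit of \<open>(n, e x)\<close> along an ultrafilter \<open>G y\<close> on \<open>L\<close>. A set of at least \<open>\<lambda>\<close> points has \<open>\<lambda>\<close> points on
  one level, as \<open>\<lambda>\<close> is regular and uncountable, so its closure has \<open>2\<^sup>\<kappa>\<close> points.

  A basic clopen set is determined by its trace on level \<open>0\<close>, which is arbitrary. For these sets to separate points it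
  suffices that any \<open>\<lambda>\<close> many points of one level are strongly discrete: they have pairwise disjoint
  neighbourhoods on the level below. A family of \<open>\<lambda>\<close> many points of \<open>P\<close> is made injective by a function
  \<open>J : P \<rightarrow> L\<close> from a fixed family of \<open>2\<^sup>\<lambda>\<close> many functions. With each \<open>J\<close> and each \<open>h : L \<rightarrow> L\<close> comes a member
  \<open>{d. d closed under h, J y < d, f d = J y}\<close> of \<open>G y\<close>, where the functions \<open>f\<close>, one for each pair \<open>(J, h)\<close>,
  are independent modulo nonstationary sets; \<open>h\<close> is chosen so that two points can collide only at the
  same \<open>d\<close>, where \<open>f d\<close> decides between them.
\<close>

section \<open>Cardinalities of sets\<close>

lemma card_of_ordLeq_surj:
  assumes "|A| \<le>o |B|" "A \<noteq> {}"
  obtains f where "f ` B = A"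
proof -
  have "\<exists>f. f ` B = A" unfolding card_of_ordLeq2[OF assms(2)] by (rule assms(1))
  then show thesis using that by blast
qed

lemma Times_ordLeq:
  assumes "infinite C" "|A| \<le>o |C|" "|B| \<le>o |C|"
  shows "|A \<times> B| \<le>o |C|"
  by (rule card_of_Sigma_ordLeq_infinite[OF assms(1,2)]) (simp add: assms(3))

lemma insert_ordLeq:
  assumes "infinite C" "|B| \<le>o |C|"
  shows "|insert x B| \<le>o |C|"
proof -
  have "infinite (Field |C| )" by (simp add: Field_card_of assms(1))
  moreover have "|{x}| \<le>o |C|" by (rule card_of_singl_ordLeq) (use assms(1) in auto)
  ultimately have "|{x} \<union> B| \<le>o |C|"
    using assms(2) card_of_Card_order by (rule card_of_Un_ordLeq_infinite_Field)
  then show ?thesis by simp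
qed

lemma Pow_mono_ordLeq:
  assumes "|A| \<le>o |B|"
  shows "|Pow A| \<le>o |Pow B|"
proof -
  obtain f where f: "inj_on f A" "f ` A \<subseteq> B"
    using assms unfolding card_of_ordLeq[symmetric] by blast
  have "inj_on (image f) (Pow A)"
    using f(1) by (rule inj_on_image_Pow)
  moreover have "image f ` Pow A \<subseteq> Pow B" using f(2) by blast
  ultimately show ?thesis unfolding card_of_ordLeq[symmetric] by blast
qed

text \<open>After embedding \<open>B\<close> in \<open>Pow C\<close>, a function from
  \<open>A\<close> to \<open>B\<close> is coded by one relation, a subset of
  \<open>A \<times> C\<close>.\<close>

lemma Func_Pow_ordLeq:
  assumes "|B| \<le>o |Pow C|"
  shows "|Func A B| \<le>o |Pow (A \<times> C)|"
proof -
  obtain f where f: "inj_on f B" "f ` B \<subseteq> Pow C"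
    using assms unfolding card_of_ordLeq[symmetric] by blast
  define \<Phi> where "\<Phi> g = (SIGMA x:A. f (g x))" for g
  have "inj_on \<Phi> (Func A B)"
  proof (rule inj_onI)
    fix g g' assume g: "g \<in> Func A B" "g' \<in> Func A B" "\<Phi> g = \<Phi> g'"
    show "g = g'"
    proof
      fix x
      show "g x = g' x"
      proof (cases "x \<in> A")
        case True
        then have "f (g x) = \<Phi> g `` {x}" "f (g' x) = \<Phi> g' `` {x}" unfolding \<Phi>_def by auto
        then have "f (g x) = f (g' x)" using g(3) by simp
        then show ?thesis using f(1) g(1,2) True unfolding Func_def inj_on_def by blast
      next
        case False
        then show ?thesis using g(1,2) unfolding Func_def by auto
      qed
    qed
  qed
  moreover have "\<Phi> ` Func A B \<subseteq> Pow (A \<times> C)"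
    using f(2) unfolding \<Phi>_def Func_def by fast
  ultimately show ?thesis unfolding card_of_ordLeq[symmetric] by blast
qed

lemma finite_subsets_ordLeq:
  assumes "infinite A"
  shows "|{X. X \<subseteq> A \<and> finite X}| \<le>o |A|"
proof -
  define F where "F n = {X. X \<subseteq> A \<and> finite X \<and> card X = n}" for n :: nat
  have "|F n| \<le>o |A|" for n
  proof (induction n)
    case 0
    have "F 0 = {{}}" unfolding F_def by auto
    moreover have "A \<noteq> {}" using assms by auto
    ultimately show ?case by (simp add: card_of_singl_ordLeq)
  next
    case (Suc n)
    have "F (Suc n) \<subseteq> (\<lambda>(a, X). insert a X) ` (A \<times> F n)"
    proof
      fix X assume "X \<in> F (Suc n)"
      then obtain a Y where "X = insert a Y" "a \<notin> Y" "card Y = n" "X \<subseteq> A" "finite X"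
        unfolding F_def by (auto simp: card_Suc_eq)
      then show "X \<in> (\<lambda>(a, X). insert a X) ` (A \<times> F n)"
        unfolding F_def by (intro image_eqI[of _ _ "(a, Y)"]) auto
    qed
    then have "|F (Suc n)| \<le>o |A \<times> F n|" by (rule surj_imp_ordLeq)
    moreover have "|A \<times> F n| \<le>o |A|"
      by (rule Times_ordLeq[OF assms card_of_mono1[OF order_refl] Suc])
    ultimately show ?case by (rule ordLeq_transitive)
  qed
  moreover have "|UNIV :: nat set| \<le>o |A|"
    using assms infinite_iff_card_of_nat[of A] by simp
  ultimately have "|\<Union>n. F n| \<le>o |A|"
    by (intro card_of_UNION_ordLeq_infinite[OF assms]) simp_all
  moreover have "(\<Union>n. F n) = {X. X \<subseteq> A \<and> finite X}" unfolding F_def by auto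
  ultimately show ?thesis by simp
qed

section \<open>Independent and separating functions\<close>

text \<open>One point from each symmetric difference suffices. The bound by
  \<open>F \<times> F\<close> serves both a finite \<open>F\<close> and a family no larger than a
  given infinite set.\<close>

lemma separating_set:
  assumes "F \<subseteq> Pow A"
  obtains u where "|u| \<le>o |F \<times> F|" "u \<subseteq> A" "inj_on (\<lambda>S. S \<inter> u) F"
proof -
  define w where "w = (\<lambda>(S, T). SOME x :: 'a. x \<in> S - T \<union> (T - S))"
  have w: "w (S, T) \<in> S - T \<union> (T - S)" if "S \<noteq> T" for S T
    unfolding w_def using someI_ex[of "\<lambda>x. x \<in> S - T \<union> (T - S)"] that by auto
  define u where "u = w ` {(S, T). S \<in> F \<and> T \<in> F \<and> S \<noteq> T}"
  show thesis
  proof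
    have "{(S, T). S \<in> F \<and> T \<in> F \<and> S \<noteq> T} \<subseteq> F \<times> F" by auto
    then show "|u| \<le>o |F \<times> F|"
      unfolding u_def by (rule ordLeq_transitive[OF card_of_image card_of_mono1])
    show "u \<subseteq> A"
    proof
      fix x assume "x \<in> u"
      then obtain S T where "S \<in> F" "T \<in> F" "S \<noteq> T" "x = w (S, T)"
        unfolding u_def by blast
      then show "x \<in> A" using w[of S T] assms by blast
    qed
    show "inj_on (\<lambda>S. S \<inter> u) F"
    proof (rule inj_onI, rule ccontr)
      fix S T assume ST: "S \<in> F" "T \<in> F" "S \<inter> u = T \<inter> u" "S \<noteq> T"
      have "(S, T) \<in> {(S, T). S \<in> F \<and> T \<in> F \<and> S \<noteq> T}" using ST(1,2,4) by simp
      then have "w (S, T) \<in> u" unfolding u_def by (rule imageI)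
      then show False using w[OF ST(4)] ST(3) by blast
    qed
  qed
qed

text \<open>
  The Engelking--Karlowicz theorem. An element of \<open>A\<close> codes a finite \<open>u \<subseteq> A\<close> and a finite table of values
  for traces on \<open>u\<close>.
\<close>
lemma independent_functions:
  fixes A :: "'a set"
  assumes "infinite A"
  shows "\<exists>\<phi> :: 'a set \<Rightarrow> 'a \<Rightarrow> 'a.
    \<forall>F v. finite F \<longrightarrow> F \<subseteq> Pow A \<longrightarrow> v ` F \<subseteq> A \<longrightarrow> (\<exists>h\<in>A. \<forall>S\<in>F. \<phi> S h = v S)"
proof -
  let ?Fin = "{X. X \<subseteq> A \<and> finite X}"
  let ?H = "?Fin \<times> {m. m \<subseteq> ?Fin \<times> A \<and> finite m}"
  have Fin: "|?Fin| \<le>o |A|" by (rule finite_subsets_ordLeq[OF assms])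
  have FinA: "|?Fin \<times> A| \<le>o |A|"
    by (rule Times_ordLeq[OF assms Fin card_of_mono1[OF order_refl]])
  have "infinite (?Fin \<times> A)"
  proof
    assume "finite (?Fin \<times> A)"
    then have "finite (snd ` (?Fin \<times> A))" by (rule finite_imageI)
    moreover have "A \<subseteq> snd ` (?Fin \<times> A)" by force
    ultimately show False using assms finite_subset by blast
  qed
  then have "|{m. m \<subseteq> ?Fin \<times> A \<and> finite m}| \<le>o |?Fin \<times> A|"
    by (rule finite_subsets_ordLeq)
  then have "|{m. m \<subseteq> ?Fin \<times> A \<and> finite m}| \<le>o |A|"
    using FinA by (rule ordLeq_transitive)
  then have H: "|?H| \<le>o |A|" by (rule Times_ordLeq[OF assms Fin])
  have "({}, {}) \<in> ?H" by simp
  then have "?H \<noteq> {}" by blast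
  then obtain \<sigma> where \<sigma>: "\<sigma> ` A = ?H" by (rule card_of_ordLeq_surj[OF H])
  \<comment> \<open>\<open>h\<close> codes a pair \<open>(u, m)\<close>, and
    \<open>\<phi> S h\<close> looks up the trace of \<open>S\<close> on \<open>u\<close> in the
    table \<open>m\<close>. When \<open>u\<close> separates \<open>F\<close>, the entry found is
    unique.\<close>
  define \<phi> where "\<phi> S h = (SOME j. (S \<inter> fst (\<sigma> h), j) \<in> snd (\<sigma> h))" for S h
  show ?thesis
  proof (intro exI[of _ \<phi>] allI impI)
    fix F v assume F: "finite F" "F \<subseteq> Pow A" and v: "v ` F \<subseteq> A"
    obtain u where u0: "|u| \<le>o |F \<times> F|" and u: "u \<subseteq> A" "inj_on (\<lambda>S. S \<inter> u) F"
      using separating_set[OF F(2)] by blast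
    have fin: "finite u" by (rule card_of_ordLeq_finite[OF u0]) (simp add: F(1))
    define m where "m = (\<lambda>S. (S \<inter> u, v S)) ` F"
    have "m \<subseteq> ?Fin \<times> A" "finite m" unfolding m_def using F u fin v by auto
    then have "(u, m) \<in> ?H" using u fin by blast
    then obtain h where h: "h \<in> A" "\<sigma> h = (u, m)" using \<sigma> by (metis imageE)
    have "\<phi> S h = v S" if "S \<in> F" for S
      unfolding \<phi>_def h(2)
    proof (rule some_equality)
      show "(S \<inter> fst (u, m), v S) \<in> snd (u, m)" using that by (simp add: m_def)
      show "j = v S" if "(S \<inter> fst (u, m), j) \<in> snd (u, m)" for j
        using that u(2) \<open>S \<in> F\<close> by (auto simp: m_def inj_on_def)
    qed
    then show "\<exists>h\<in>A. \<forall>S\<in>F. \<phi> S h = v S" using h(1) by blast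
  qed
qed

text \<open>At most \<open>|A|\<close> elements of \<open>K\<close> already tell the members of
  \<open>Q\<close> apart. A pair \<open>(d, s)\<close> lists such elements and the resulting traces,
  both along \<open>A\<close>, and \<open>J (d, s)\<close> sends a set to an index of its trace.
  There are at most \<open>|Pow A|\<close> such pairs.\<close>

lemma separating_functions:
  fixes A :: "'a set" and K :: "'k set"
  assumes A: "infinite A" and K: "K \<noteq> {}" "|K| \<le>o |Pow A|"
  shows "\<exists>\<J> :: ('k set \<Rightarrow> 'a) set. |\<J>| \<le>o |Pow A| \<and> (\<forall>J\<in>\<J>. range J \<subseteq> A) \<and>
    (\<forall>Q. Q \<subseteq> Pow K \<longrightarrow> |Q| \<le>o |A| \<longrightarrow> (\<exists>J\<in>\<J>. inj_on J Q))"
proof -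
  obtain a0 where a0: "a0 \<in> A" using A by (metis ex_in_conv finite.emptyI)
  define \<tau> where "\<tau> d y = {x \<in> A. d x \<in> y}" for d :: "'a \<Rightarrow> 'k" and y
  define J where "J = (\<lambda>(d, s) y. if \<tau> d y \<in> s ` A then inv_into A s (\<tau> d y) else a0)"
  have AA: "|A \<times> A| \<le>o |A|" by (rule Times_ordLeq[OF A]) (simp_all add: card_of_refl ordIso_imp_ordLeq)
  then have PAA: "|Pow (A \<times> A)| \<le>o |Pow A|" by (rule Pow_mono_ordLeq)
  have "|Func A K| \<le>o |Pow A|"
    by (rule ordLeq_transitive[OF Func_Pow_ordLeq[OF K(2)] PAA])
  moreover have "|Func A (Pow A)| \<le>o |Pow A|"
    by (rule ordLeq_transitive[OF Func_Pow_ordLeq[OF card_of_mono1[OF order_refl]] PAA])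
  moreover have "infinite (Pow A)" using A by simp
  ultimately have "|Func A K \<times> Func A (Pow A)| \<le>o |Pow A|" by (intro Times_ordLeq)
  then have "|J ` (Func A K \<times> Func A (Pow A))| \<le>o |Pow A|"
    by (rule ordLeq_transitive[OF card_of_image])
  moreover have "J p y \<in> A" for p y
    using a0 inv_into_into[of "\<tau> (fst p) y" "snd p" A] by (simp add: J_def case_prod_beta)
  then have "\<forall>j\<in>J ` (Func A K \<times> Func A (Pow A)). range j \<subseteq> A"
    by blast
  moreover have "\<exists>j\<in>J ` (Func A K \<times> Func A (Pow A)). inj_on j Q"
    if Q: "Q \<subseteq> Pow K" "|Q| \<le>o |A|" for Q
  proof -
    obtain u where u: "|u| \<le>o |Q \<times> Q|" "u \<subseteq> K" "inj_on (\<lambda>y. y \<inter> u) Q"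
      using separating_set[OF Q(1)] by blast
    obtain k0 where k0: "k0 \<in> K" using K(1) by blast
    \<comment> \<open>\<open>k0\<close> keeps \<open>D\<close> nonempty, so that \<open>A\<close>
      can be mapped onto it; the empty trace is added below for the same reason, as \<open>Q\<close>
      may be empty.\<close>
    define D where "D = insert k0 u"
    have "D \<subseteq> K" using k0 u(2) by (simp add: D_def)
    have "|Q \<times> Q| \<le>o |A|" by (rule Times_ordLeq[OF A Q(2) Q(2)])
    with u(1) have "|u| \<le>o |A|" by (rule ordLeq_transitive)
    then have "|D| \<le>o |A|" unfolding D_def by (rule insert_ordLeq[OF A])
    moreover have "D \<noteq> {}" unfolding D_def by simp
    ultimately obtain d0 where d0: "d0 ` A = D" by (rule card_of_ordLeq_surj)
    define d where "d x = (if x \<in> A then d0 x else undefined)" for x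
    have d: "d \<in> Func A K" "d ` A = D"
      using d0 \<open>D \<subseteq> K\<close> by (auto simp: d_def Func_def)
    have inj: "inj_on (\<tau> d) Q"
    proof (rule inj_onI)
      fix y z assume yz: "y \<in> Q" "z \<in> Q" "\<tau> d y = \<tau> d z"
      have "k \<in> y \<longleftrightarrow> k \<in> z" if "k \<in> u" for k
      proof -
        have "k \<in> d ` A" using that unfolding d(2) D_def by simp
        then obtain x where x: "k = d x" "x \<in> A" by (rule imageE)
        have "x \<in> \<tau> d y \<longleftrightarrow> x \<in> \<tau> d z" using yz(3) by simp
        then show ?thesis using x by (simp add: \<tau>_def)
      qed
      then have "y \<inter> u = z \<inter> u" by blast
      then show "y = z" using u(3) yz(1,2) by (simp add: inj_on_def)
    qed
    have "|\<tau> d ` Q| \<le>o |A|" by (rule ordLeq_transitive[OF card_of_image Q(2)])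
    then have "|insert {} (\<tau> d ` Q)| \<le>o |A|" by (rule insert_ordLeq[OF A])
    then obtain s0 where s0: "s0 ` A = insert {} (\<tau> d ` Q)"
      by (rule card_of_ordLeq_surj) simp
    define s where "s x = (if x \<in> A then s0 x else undefined)" for x
    have sA: "s ` A = insert {} (\<tau> d ` Q)" using s0 by (auto simp: s_def)
    have "insert {} (\<tau> d ` Q) \<subseteq> Pow A" by (auto simp: \<tau>_def)
    then have "s ` A \<subseteq> Pow A" by (simp only: sA)
    then have s: "s \<in> Func A (Pow A)" by (auto simp: Func_def s_def)
    have "inj_on (J (d, s)) Q"
    proof (rule inj_onI)
      fix y z assume yz: "y \<in> Q" "z \<in> Q" "J (d, s) y = J (d, s) z"
      have "s (J (d, s) v) = \<tau> d v" if "v \<in> Q" for v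
      proof -
        have "\<tau> d v \<in> s ` A" using that sA by simp
        then show ?thesis by (simp add: J_def f_inv_into_f)
      qed
      then have "\<tau> d y = \<tau> d z" using yz by metis
      then show "y = z" using inj yz(1,2) by (simp add: inj_on_def)
    qed
    then show ?thesis using d(1) s by blast
  qed
  ultimately show ?thesis
    by (intro exI[of _ "J ` (Func A K \<times> Func A (Pow A))"] conjI allI impI)
qed

section \<open>Ultrafilters on a set\<close>

definition ultrafilter_on :: "'a set \<Rightarrow> 'a set set \<Rightarrow> bool" where
  "ultrafilter_on A G \<longleftrightarrow> G \<subseteq> Pow A \<and> {} \<notin> G \<and>
     (\<forall>S\<in>G. \<forall>T\<in>G. S \<inter> T \<in> G) \<and> (\<forall>S. S \<subseteq> A \<longrightarrow> S \<in> G \<or> A - S \<in> G)"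

lemma ultrafilter_nonempty: "ultrafilter_on A G \<Longrightarrow> S \<in> G \<Longrightarrow> S \<noteq> {}"
  by (auto simp: ultrafilter_on_def)

lemma ultrafilter_Int: "ultrafilter_on A G \<Longrightarrow> S \<in> G \<Longrightarrow> T \<in> G \<Longrightarrow> S \<inter> T \<in> G"
  by (simp add: ultrafilter_on_def)

lemma ultrafilter_subset: "ultrafilter_on A G \<Longrightarrow> S \<in> G \<Longrightarrow> S \<subseteq> A"
  by (auto simp: ultrafilter_on_def)

lemma ultrafilter_mono:
  assumes "ultrafilter_on A G" "S \<in> G" "S \<subseteq> T" "T \<subseteq> A"
  shows "T \<in> G"
proof (rule ccontr)
  assume "T \<notin> G"
  then have "A - T \<in> G" using assms unfolding ultrafilter_on_def by blast
  then have "S \<inter> (A - T) \<in> G" using assms unfolding ultrafilter_on_def by blast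
  moreover have "S \<inter> (A - T) = {}" using assms by blast
  ultimately show False using assms unfolding ultrafilter_on_def by simp
qed

lemma ultrafilter_Int_iff:
  assumes "ultrafilter_on A G" "S \<subseteq> A" "T \<subseteq> A"
  shows "S \<inter> T \<in> G \<longleftrightarrow> S \<in> G \<and> T \<in> G"
proof
  assume "S \<inter> T \<in> G"
  then show "S \<in> G \<and> T \<in> G"
    using ultrafilter_mono[OF assms(1), of "S \<inter> T"] assms(2,3) by simp
next
  assume "S \<in> G \<and> T \<in> G"
  then show "S \<inter> T \<in> G" using assms(1) by (simp add: ultrafilter_on_def)
qed

lemma ultrafilter_Diff_iff:
  assumes "ultrafilter_on A G" "S \<subseteq> A"
  shows "A - S \<in> G \<longleftrightarrow> S \<notin> G"
proof -
  have "S \<inter> (A - S) = {}" by blast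
  then show ?thesis using assms unfolding ultrafilter_on_def by metis
qed

text \<open>Zorn's lemma gives a maximal family with the finite intersection property, and
  maximality decides every subset of \<open>A\<close>.\<close>

lemma ultrafilter_exists:
  fixes A :: "'a set"
  assumes B: "B \<subseteq> Pow A" and fip: "\<And>F. finite F \<Longrightarrow> F \<subseteq> B \<Longrightarrow> A \<inter> \<Inter>F \<noteq> {}"
  shows "\<exists>G. ultrafilter_on A G \<and> B \<subseteq> G"
proof -
  define fip where "fip M \<longleftrightarrow> (\<forall>F. finite F \<longrightarrow> F \<subseteq> M \<longrightarrow> A \<inter> \<Inter>F \<noteq> {})" for M :: "'a set set"
  define \<A> where "\<A> = {M. B \<subseteq> M \<and> M \<subseteq> Pow A \<and> fip M}"
  have "\<exists>M\<in>\<A>. \<forall>N\<in>\<A>. M \<subseteq> N \<longrightarrow> N = M"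
  proof (rule subset_Zorn_nonempty)
    show "\<A> \<noteq> {}" using assms unfolding \<A>_def fip_def by blast
    fix \<C> assume \<C>: "\<C> \<noteq> {}" "subset.chain \<A> \<C>"
    then have mem: "B \<subseteq> M" "M \<subseteq> Pow A" "fip M" if "M \<in> \<C>" for M
      using that by (auto simp: subset_chain_def \<A>_def)
    have "fip (\<Union>\<C>)"
      unfolding fip_def
    proof (intro allI impI)
      fix F assume F: "finite F" "F \<subseteq> \<Union>\<C>"
      then obtain M where "M \<in> \<C>" "F \<subseteq> M"
        using finite_subset_Union_chain[OF F \<C>] by blast
      then show "A \<inter> \<Inter>F \<noteq> {}"
        using mem(3)[of M] F(1) unfolding fip_def by simp
    qed
    moreover have "B \<subseteq> \<Union>\<C>" using \<C>(1) mem(1) by blast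
    moreover have "\<Union>\<C> \<subseteq> Pow A" using mem(2) by (rule Union_least)
    ultimately show "\<Union>\<C> \<in> \<A>" by (simp add: \<A>_def)
  qed
  then obtain M where M: "M \<in> \<A>" "\<And>N. N \<in> \<A> \<Longrightarrow> M \<subseteq> N \<Longrightarrow> N = M" by blast
  have fipM: "A \<inter> \<Inter>F \<noteq> {}" if "finite F" "F \<subseteq> M" for F
    using M(1) that by (simp add: \<A>_def fip_def)
  \<comment> \<open>By maximality, a subset of \<open>A\<close> that meets all finite intersections
    already belongs to \<open>M\<close>. Closure under intersection and the dichotomy both follow
    from this.\<close>
  have ins: "S \<in> M" if S: "S \<subseteq> A" and ne: "\<And>F. finite F \<Longrightarrow> F \<subseteq> M \<Longrightarrow> A \<inter> \<Inter>F \<inter> S \<noteq> {}" for S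
  proof -
    have "fip (insert S M)"
      unfolding fip_def
    proof (intro allI impI)
      fix F assume F: "finite F" "F \<subseteq> insert S M"
      have "A \<inter> \<Inter>(F - {S}) \<inter> S \<noteq> {}" using F by (intro ne) auto
      moreover have "A \<inter> \<Inter>(F - {S}) \<inter> S \<subseteq> A \<inter> \<Inter>F" by auto
      ultimately show "A \<inter> \<Inter>F \<noteq> {}" by blast
    qed
    then have "insert S M \<in> \<A>" using M(1) S by (auto simp: \<A>_def)
    then show ?thesis using M(2) by blast
  qed
  show ?thesis
  proof (intro exI[of _ M] conjI)
    show "B \<subseteq> M" using M(1) by (simp add: \<A>_def)
    show "ultrafilter_on A M"
      unfolding ultrafilter_on_def
    proof (intro conjI ballI allI impI)
      show MA: "M \<subseteq> Pow A" using M(1) by (simp add: \<A>_def)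
      show "{} \<notin> M" using fipM[of "{{}}"] by auto
      show "S \<inter> T \<in> M" if ST: "S \<in> M" "T \<in> M" for S T
      proof (rule ins)
        show "S \<inter> T \<subseteq> A" using ST MA by blast
        fix F assume "finite F" "F \<subseteq> M"
        then have "A \<inter> \<Inter>(insert S (insert T F)) \<noteq> {}" using ST by (intro fipM) auto
        then show "A \<inter> \<Inter>F \<inter> (S \<inter> T) \<noteq> {}" by auto
      qed
      show "S \<in> M \<or> A - S \<in> M" if S: "S \<subseteq> A" for S
      proof (rule ccontr)
        assume neg: "\<not> ?thesis"
        obtain F where F: "finite F" "F \<subseteq> M" "A \<inter> \<Inter>F \<inter> S = {}" using ins[OF S] neg by blast
        obtain F' where F': "finite F'" "F' \<subseteq> M" "A \<inter> \<Inter>F' \<inter> (A - S) = {}"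
          using ins[of "A - S"] neg by blast
        have "A \<inter> \<Inter>(F \<union> F') \<noteq> {}" using F F' by (intro fipM) auto
        then show False using F(3) F'(3) by blast
      qed
    qed
  qed
qed

section \<open>Stationary sets\<close>

locale regular_uncountable =
  fixes lam :: "'a rel"
  assumes Card: "Card_order lam" and regular: "regularCard lam" and uncountable: "natLeq <o lam"
begin

abbreviation L :: "'a set" where "L \<equiv> Field lam"

definition less :: "'a \<Rightarrow> 'a \<Rightarrow> bool" (infix \<open>\<lless>\<close> 50)
  where "a \<lless> b \<longleftrightarrow> (a, b) \<in> lam \<and> a \<noteq> b"

definition small :: "'b set \<Rightarrow> bool" where "small X \<longleftrightarrow> |X| <o lam"

lemma infinite_L: "infinite L"
proof -
  have "natLeq \<le>o |L|"
    by (rule ordLeq_ordIso_trans[OF ordLess_imp_ordLeq[OF uncountable]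
          ordIso_symmetric[OF card_of_Field_ordIso[OF Card]]])
  then show ?thesis using infinite_iff_natLeq_ordLeq by blast
qed

lemma L_nonempty: "L \<noteq> {}"
  using infinite_L by auto

lemma Cinfinite: "Cinfinite lam"
  using Card infinite_L by (simp add: cinfinite_def)

lemma wo: "Well_order lam" "wo_rel lam"
  using Card by (auto simp: card_order_on_def wo_rel_def)

section \<open>The well-order on the field of \<open>lam\<close>\<close>

lemma less_irrefl: "\<not> a \<lless> a"
  by (simp add: less_def)

lemma less_in_L: "a \<lless> b \<Longrightarrow> a \<in> L" "a \<lless> b \<Longrightarrow> b \<in> L"
  by (auto simp: less_def Field_def)

lemma less_trans: "a \<lless> b \<Longrightarrow> b \<lless> c \<Longrightarrow> a \<lless> c"
  using wo_rel.TRANS[OF wo(2)] wo_rel.ANTISYM[OF wo(2)]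
  unfolding less_def trans_def antisym_def by blast

lemma less_linear: "a \<in> L \<Longrightarrow> b \<in> L \<Longrightarrow> a \<lless> b \<or> a = b \<or> b \<lless> a"
  unfolding less_def using wo_rel.TOTALS[OF wo(2)] by auto

lemma less_asym: "a \<lless> b \<Longrightarrow> \<not> b \<lless> a"
  using less_trans less_irrefl by blast

lemma less_least:
  assumes "A \<subseteq> L" "A \<noteq> {}"
  shows "\<exists>a\<in>A. \<forall>b\<in>A. \<not> b \<lless> a"
proof -
  have "wo_rel.minim lam A \<in> A" by (rule wo_rel.minim_in[OF wo(2) assms])
  moreover have "\<not> b \<lless> wo_rel.minim lam A" if "b \<in> A" for b
    using wo_rel.minim_least[OF wo(2) assms(1) that] wo_rel.ANTISYM[OF wo(2)]
    unfolding less_def antisym_def by blast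
  ultimately show ?thesis by blast
qed

section \<open>Sets of size less than \<open>lam\<close>\<close>

lemma small_subset: "small X \<Longrightarrow> Y \<subseteq> X \<Longrightarrow> small Y"
  unfolding small_def by (rule ordLeq_ordLess_trans[OF card_of_mono1])

lemma small_image: "small X \<Longrightarrow> small (f ` X)"
  unfolding small_def by (rule ordLeq_ordLess_trans[OF card_of_image])

lemma small_countable: "countable X \<Longrightarrow> small X"
proof -
  assume "countable X"
  then have "|X| \<le>o |UNIV :: nat set|"
    unfolding countable_def card_of_ordLeq[symmetric] by blast
  then have "|X| \<le>o natLeq" by (rule ordLeq_ordIso_trans[OF _ card_of_nat])
  then show ?thesis unfolding small_def by (rule ordLeq_ordLess_trans[OF _ uncountable])
qed

lemma small_finite: "finite X \<Longrightarrow> small X"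
  by (simp add: small_countable countable_finite)

lemma small_UN:
  assumes "small I" "\<And>i. i \<in> I \<Longrightarrow> small (A i)"
  shows "small (\<Union>i\<in>I. A i)"
  unfolding small_def
  by (rule card_of_UNION_ordLess_infinite_Field_regularCard[OF regular Cinfinite
        assms(1)[unfolded small_def] ballI[OF assms(2)[unfolded small_def]]])

lemma small_Un: "small A \<Longrightarrow> small B \<Longrightarrow> small (A \<union> B)"
  unfolding small_def by (rule Un_Cinfinite_bound_strict[OF _ _ Cinfinite])

lemma small_Times:
  assumes "small A" "small B"
  shows "small (A \<times> B)"
proof -
  have "A \<times> B = (\<Union>a\<in>A. Pair a ` B)" by auto
  then show ?thesis by (simp only: small_UN[OF assms(1) small_image[OF assms(2)]])
qed

lemma small_below: "small {b. b \<lless> a}"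
proof (cases "a \<in> L")
  case True
  have "{b. b \<lless> a} \<subseteq> underS lam a" by (auto simp: less_def underS_def)
  moreover have "small (underS lam a)"
    unfolding small_def by (rule card_of_underS[OF Card True])
  ultimately show ?thesis by (rule small_subset[rotated])
next
  case False
  then have "{b. b \<lless> a} = {}" using less_in_L by auto
  then show ?thesis by (simp add: small_finite)
qed

lemma small_atMost: "small {b. b \<lless> a \<or> b = a}"
proof -
  have "{b. b \<lless> a \<or> b = a} = {b. b \<lless> a} \<union> {a}" by auto
  then show ?thesis using small_Un[OF small_below small_finite[of "{a}"]] by simp
qed

lemma not_small:
  assumes "\<not> small A"
  shows "|L| \<le>o |A|"
proof -
  have "lam \<le>o |A|"
    using assms not_ordLess_iff_ordLeq[OF wo(1) card_of_Well_order] unfolding small_def by blast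
  then show ?thesis by (rule ordIso_ordLeq_trans[OF card_of_Field_ordIso[OF Card]])
qed

text \<open>Regularity excludes that \<open>X\<close> is cofinal. The bound this yields is weak, and
  a larger point makes it strict.\<close>

lemma small_bounded:
  assumes "small X" "X \<subseteq> L"
  shows "\<exists>b\<in>L. \<forall>x\<in>X. x \<lless> b"
proof -
  have "\<not> cofinal X lam"
    using assms regular not_ordLess_ordIso[of "|X|" lam] unfolding regularCard_def small_def by blast
  then obtain a where a: "a \<in> L" "\<And>x. x \<in> X \<Longrightarrow> \<not> a \<lless> x"
    unfolding cofinal_def less_def by blast
  obtain b where b: "b \<in> L" "a \<lless> b"
    using infinite_Card_order_limit[OF Card infinite_L a(1)] unfolding less_def by blast
  have "x \<lless> b" if "x \<in> X" for x
    using less_linear[of a x] a b that assms(2) less_trans by blast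
  with b show ?thesis by blast
qed

section \<open>Closure points and stationary sets\<close>

definition closed_under :: "('a \<Rightarrow> 'a) \<Rightarrow> 'a \<Rightarrow> bool" where
  "closed_under h d \<longleftrightarrow> (\<forall>x. x \<lless> d \<longrightarrow> h x \<lless> d)"

text \<open>
  The points closed under a function \<open>h\<close> form a closed unbounded set, and such sets generate the club
  filter, so this is the usual notion of a stationary subset.
\<close>
definition stationary :: "'a set \<Rightarrow> bool" where
  "stationary S \<longleftrightarrow> S \<subseteq> L \<and> (\<forall>h j. h ` L \<subseteq> L \<longrightarrow> j \<in> L \<longrightarrow> (\<exists>d\<in>S. j \<lless> d \<and> closed_under h d))"

definition ladder :: "(nat \<Rightarrow> 'a) \<Rightarrow> 'a \<Rightarrow> bool" where
  "ladder \<eta> d \<longleftrightarrow> (\<forall>n. \<eta> n \<lless> d) \<and> (\<forall>x. x \<lless> d \<longrightarrow> (\<exists>n. \<not> \<eta> n \<lless> x))"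

text \<open>Merges fewer than \<open>lam\<close> closure requirements at each point into one
  function: if \<open>d\<close> is closed under \<open>h\<close> and \<open>x \<lless> d\<close>,
  all of \<open>B x\<close> lies below \<open>d\<close>.\<close>

lemma pointwise_bound:
  assumes "\<And>x. x \<in> L \<Longrightarrow> small (B x)" "\<And>x. x \<in> L \<Longrightarrow> B x \<subseteq> L"
  shows "\<exists>h. h ` L \<subseteq> L \<and> (\<forall>x\<in>L. \<forall>b\<in>B x. b \<lless> h x)"
proof -
  have "\<exists>c\<in>L. \<forall>b\<in>B x. b \<lless> c" if "x \<in> L" for x
    by (rule small_bounded[OF assms(1)[OF that] assms(2)[OF that]])
  then obtain h where "\<forall>x\<in>L. h x \<in> L \<and> (\<forall>b\<in>B x. b \<lless> h x)" by metis
  then show ?thesis by blast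
qed

text \<open>A suitable function is iterated from \<open>j\<close>. As \<open>lam\<close> is regular
  and uncountable, the resulting sequence has a least strict upper bound \<open>d\<close>; it is
  closed under \<open>h\<close> and has the sequence as a ladder.\<close>

lemma stationary_ladders: "stationary {d \<in> L. \<exists>\<eta>. ladder \<eta> d}"
  unfolding stationary_def
proof (intro conjI allI impI)
  fix h j assume h: "h ` L \<subseteq> L" and j: "j \<in> L"
  define B where "B x = {y. y \<lless> x \<or> y = x} \<union> h ` {y. y \<lless> x \<or> y = x}" for x
  have "small (B x)" for x
    unfolding B_def by (intro small_Un small_image small_atMost)
  moreover have "B x \<subseteq> L" if "x \<in> L" for x
    unfolding B_def using that h less_in_L by auto
  ultimately obtain g where g: "g ` L \<subseteq> L" "\<forall>x\<in>L. \<forall>b\<in>B x. b \<lless> g x"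
    using pointwise_bound[of B] by blast
  define \<eta> where "\<eta> n = (g ^^ n) j" for n
  have \<eta>L: "\<eta> n \<in> L" for n
    by (induction n) (use j g(1) in \<open>auto simp: \<eta>_def\<close>)
  let ?U = "{d \<in> L. \<forall>n. \<eta> n \<lless> d}"
  have "small (range \<eta>)" by (rule small_countable) simp
  then obtain u where "u \<in> L" "\<forall>x\<in>range \<eta>. x \<lless> u"
    using small_bounded[of "range \<eta>"] \<eta>L by blast
  then have "u \<in> ?U" by blast
  then obtain d where d: "d \<in> ?U" "\<forall>b\<in>?U. \<not> b \<lless> d"
    using less_least[of ?U] by blast
  have cof: "\<exists>n. x \<lless> \<eta> n \<or> x = \<eta> n" if "x \<lless> d" for x
    using d that less_linear less_in_L(1)[OF that] \<eta>L by blast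
  then have "ladder \<eta> d"
    unfolding ladder_def using d less_asym less_irrefl by blast
  moreover have "j \<lless> d" using d(1) \<eta>_def[of 0] by auto
  moreover have "closed_under h d"
    unfolding closed_under_def
  proof (intro allI impI)
    fix x assume "x \<lless> d"
    then obtain n where "x \<lless> \<eta> n \<or> x = \<eta> n" using cof by blast
    then have "h x \<in> B (\<eta> n)" unfolding B_def by blast
    then have "h x \<lless> g (\<eta> n)" using g(2) \<eta>L by blast
    also have "g (\<eta> n) = \<eta> (Suc n)" by (simp add: \<eta>_def)
    finally show "h x \<lless> d" using d(1) less_trans by blast
  qed
  ultimately show "\<exists>d\<in>{d \<in> L. \<exists>\<eta>. ladder \<eta> d}. j \<lless> d \<and> closed_under h d"
    using d(1) by blast
qed auto

text \<open>Fodor's pressing-down lemma: the diagonal intersection of clubs is obtained from the bound \<open>g\<close>.\<close>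
lemma stationary_fibre:
  assumes S: "stationary S" and f: "\<And>d. d \<in> S \<Longrightarrow> f d \<lless> d"
  shows "\<exists>a\<in>L. stationary {d \<in> S. f d = a}"
proof (rule ccontr)
  assume "\<not> ?thesis"
  then have ns: "\<not> stationary {d \<in> S. f d = a}" if "a \<in> L" for a using that by blast
  have SL: "S \<subseteq> L" using S by (simp add: stationary_def)
  have "\<exists>h j. h ` L \<subseteq> L \<and> j \<in> L \<and> (\<forall>d. d \<in> S \<longrightarrow> f d = a \<longrightarrow> j \<lless> d \<longrightarrow> \<not> closed_under h d)"
    if "a \<in> L" for a
    using ns[OF that] SL unfolding stationary_def by blast
  then obtain h j where hj: "\<And>a. a \<in> L \<Longrightarrow> h a ` L \<subseteq> L" "\<And>a. a \<in> L \<Longrightarrow> j a \<in> L"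
    "\<And>a d. a \<in> L \<Longrightarrow> d \<in> S \<Longrightarrow> f d = a \<Longrightarrow> j a \<lless> d \<Longrightarrow> \<not> closed_under (h a) d"
    by metis
  \<comment> \<open>Both indices run up to \<open>x\<close>: for \<open>a\<close> and
    \<open>y\<close> below \<open>d\<close> the larger of them is below \<open>d\<close>, so closure
    of \<open>d\<close> under \<open>g\<close> puts \<open>h a y\<close> below
    \<open>d\<close>.\<close>
  define B where "B x = j ` {y. y \<lless> x \<or> y = x} \<union>
    (\<lambda>(a, y). h a y) ` ({y. y \<lless> x \<or> y = x} \<times> {y. y \<lless> x \<or> y = x})" for x
  have "small (B x)" for x
    unfolding B_def by (intro small_Un small_image small_Times small_atMost)
  moreover have "B x \<subseteq> L" if "x \<in> L" for x
  proof -
    have "y \<in> L" if "y \<lless> x \<or> y = x" for y using that \<open>x \<in> L\<close> less_in_L by blast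
    then show ?thesis
      unfolding B_def using hj(1)[THEN subsetD, OF _ imageI] hj(2) by auto
  qed
  ultimately obtain g where "g ` L \<subseteq> L" "\<forall>x\<in>L. \<forall>b\<in>B x. b \<lless> g x"
    using pointwise_bound[of B] by blast
  then have g: "g ` L \<subseteq> L" "\<And>x b. x \<in> L \<Longrightarrow> b \<in> B x \<Longrightarrow> b \<lless> g x" by blast+
  obtain j0 where j0: "j0 \<in> L" using L_nonempty by blast
  obtain d where d: "d \<in> S" "closed_under g d"
    using S g(1) j0 unfolding stationary_def by blast
  define a where "a = f d"
  have a: "a \<lless> d" "a \<in> L" using f[OF d(1)] less_in_L by (auto simp: a_def)
  have gd: "g x \<lless> d" if "x \<lless> d" for x using d(2) that by (simp add: closed_under_def)
  have "j a \<lless> d"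
    using g(2)[OF a(2), of "j a"] gd[OF a(1)] less_trans by (auto simp: B_def)
  moreover have "closed_under (h a) d"
    unfolding closed_under_def
  proof (intro allI impI)
    fix x assume x: "x \<lless> d"
    obtain m where m: "m \<lless> d" "a \<lless> m \<or> a = m" "x \<lless> m \<or> x = m"
      using a x less_linear[of a x] less_in_L by blast
    then have "h a x \<in> B m" unfolding B_def by (intro UnI2) (auto intro!: image_eqI[of _ _ "(a, x)"])
    then show "h a x \<lless> d" using g(2)[of m] gd[OF m(1)] m(1) less_in_L less_trans by blast
  qed
  ultimately show False using hj(3)[OF a(2) d(1)] a_def by blast
qed

lemma stationary_mono: "stationary S \<Longrightarrow> S \<subseteq> S' \<Longrightarrow> S' \<subseteq> L \<Longrightarrow> stationary S'"
  unfolding stationary_def by blast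

lemma stationary_nonempty:
  assumes "stationary S"
  shows "S \<noteq> {}"
proof -
  obtain j where "j \<in> L" using L_nonempty by blast
  moreover have "id ` L \<subseteq> L" by simp
  ultimately show ?thesis using assms unfolding stationary_def by blast
qed

text \<open>
  A case of Solovay's splitting theorem. Choose a ladder at every point of cofinality \<open>\<omega>\<close>; some fixed rung
  is a regressive function that exceeds any given bound on a stationary set.
\<close>
lemma stationary_partition: "\<exists>\<pi>. \<pi> ` L \<subseteq> L \<and> (\<forall>a\<in>L. stationary {d \<in> L. \<pi> d = a})"
proof -
  define E where "E = {d \<in> L. \<exists>\<eta>. ladder \<eta> d}"
  then have EL: "E \<subseteq> L" by auto
  have "\<forall>d\<in>E. \<exists>\<eta>. ladder \<eta> d" by (auto simp: E_def)
  then obtain \<eta> where \<eta>: "\<And>d. d \<in> E \<Longrightarrow> ladder (\<eta> d) d" by metis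
  have "\<exists>n. \<forall>x\<in>L. stationary {d \<in> E. \<not> \<eta> d n \<lless> x}"
  proof (rule ccontr)
    assume "\<not> ?thesis"
    then have "\<forall>n. \<exists>x\<in>L. \<not> stationary {d \<in> E. \<not> \<eta> d n \<lless> x}" by blast
    moreover have "\<exists>h j. h ` L \<subseteq> L \<and> j \<in> L \<and>
        (\<forall>d\<in>E. \<not> \<eta> d n \<lless> x \<longrightarrow> j \<lless> d \<longrightarrow> \<not> closed_under h d)"
      if "\<not> stationary {d \<in> E. \<not> \<eta> d n \<lless> x}" for n x
    proof -
      have "{d \<in> E. \<not> \<eta> d n \<lless> x} \<subseteq> L" using EL by blast
      with that show ?thesis unfolding stationary_def by blast
    qed
    ultimately have "\<forall>n. \<exists>x h j. x \<in> L \<and> h ` L \<subseteq> L \<and> j \<in> L \<and>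
        (\<forall>d\<in>E. \<not> \<eta> d n \<lless> x \<longrightarrow> j \<lless> d \<longrightarrow> \<not> closed_under h d)"
      by blast
    then obtain x h j where xhj: "\<And>n. x n \<in> L" "\<And>n. h n ` L \<subseteq> L" "\<And>n. j n \<in> L"
        "\<And>n d. d \<in> E \<Longrightarrow> \<not> \<eta> d n \<lless> x n \<Longrightarrow> j n \<lless> d \<Longrightarrow> \<not> closed_under (h n) d"
      by metis
    \<comment> \<open>The witnesses against all rungs are merged into \<open>g\<close> and
      \<open>c\<close>: a ladder point \<open>d\<close> above \<open>c\<close> that is closed under
      \<open>g\<close> has its whole ladder below \<open>c\<close>, so the ladder is not cofinal in
      \<open>d\<close>.\<close>
    have "small (range (\<lambda>n. h n y))" for y by (rule small_countable) simp
    moreover have "range (\<lambda>n. h n y) \<subseteq> L" if "y \<in> L" for y using xhj(2) that by blast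
    ultimately obtain g where "g ` L \<subseteq> L" "\<forall>y\<in>L. \<forall>b\<in>range (\<lambda>n. h n y). b \<lless> g y"
      using pointwise_bound[of "\<lambda>y. range (\<lambda>n. h n y)"] by blast
    then have g: "g ` L \<subseteq> L" "\<And>y n. y \<in> L \<Longrightarrow> h n y \<lless> g y" by blast+
    have "small (range x \<union> range j)" by (rule small_countable) simp
    moreover have "range x \<union> range j \<subseteq> L" using xhj(1,3) by blast
    ultimately have "\<exists>c\<in>L. \<forall>y\<in>range x \<union> range j. y \<lless> c" by (rule small_bounded)
    then obtain c where c: "c \<in> L" "\<And>y. y \<in> range x \<union> range j \<Longrightarrow> y \<lless> c" by blast
    obtain d where d: "d \<in> E" "c \<lless> d" "closed_under g d"
      using stationary_ladders g(1) c(1) unfolding stationary_def E_def[symmetric] by blast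
    have "closed_under (h n) d" for n
      unfolding closed_under_def
    proof (intro allI impI)
      fix y assume "y \<lless> d"
      then have "h n y \<lless> g y" "g y \<lless> d"
        using g(2)[of y n] d(3) less_in_L by (auto simp: closed_under_def)
      then show "h n y \<lless> d" using less_trans by blast
    qed
    moreover have "j n \<lless> d" for n using c(2)[of "j n"] d(2) less_trans by blast
    ultimately have "\<eta> d n \<lless> x n" for n using xhj(4) d(1) by blast
    moreover have "x n \<lless> c" for n using c(2)[of "x n"] by blast
    ultimately have "\<eta> d n \<lless> c" for n using less_trans by blast
    then show False using \<eta>[OF d(1)] d(2) unfolding ladder_def by blast
  qed
  then obtain n where n: "\<And>x. x \<in> L \<Longrightarrow> stationary {d \<in> E. \<not> \<eta> d n \<lless> x}" by blast
  define f where "f d = \<eta> d n" for d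
  have f: "f d \<lless> d" if "d \<in> E" for d using \<eta>[OF that] by (simp add: f_def ladder_def)
  \<comment> \<open>Fodor's lemma, applied to rungs beyond each bound \<open>x\<close>, makes
    \<open>A\<close> unbounded; by regularity \<open>A\<close> can then be mapped onto
    \<open>L\<close>.\<close>
  define A where "A = {a \<in> L. stationary {d \<in> E. f d = a}}"
  have "\<exists>a\<in>A. \<not> a \<lless> x" if "x \<in> L" for x
  proof -
    have "\<exists>a\<in>L. stationary {d \<in> {d \<in> E. \<not> f d \<lless> x}. f d = a}"
      by (rule stationary_fibre) (use n[OF that] f in \<open>auto simp: f_def\<close>)
    then obtain a where a: "stationary {d \<in> {d \<in> E. \<not> f d \<lless> x}. f d = a}" "a \<in> L"
      by blast
    then have "stationary {d \<in> E. f d = a}"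
      by (intro stationary_mono[OF a(1)]) (use EL in auto)
    moreover have "\<not> a \<lless> x"
      using stationary_nonempty[OF a(1)] by blast
    ultimately show ?thesis using a(2) by (auto simp: A_def)
  qed
  then have "\<not> small A"
    using small_bounded[of A] less_asym unfolding A_def by blast
  then have "|L| \<le>o |A|" by (rule not_small)
  then obtain \<beta> where \<beta>: "\<beta> ` A = L" using L_nonempty by (rule card_of_ordLeq_surj)
  obtain l0 where l0: "l0 \<in> L" using L_nonempty by blast
  \<comment> \<open>Values in \<open>A\<close> are relabelled by \<open>\<beta>\<close>. The default
    \<open>l0\<close> at other points only enlarges one fibre, which stays stationary.\<close>
  define \<pi> where "\<pi> d = (if f d \<in> A then \<beta> (f d) else l0)" for d
  show ?thesis
  proof (intro exI conjI ballI)
    show "\<pi> ` L \<subseteq> L" using \<beta> l0 by (auto simp: \<pi>_def)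
    fix b assume "b \<in> L"
    then have "b \<in> \<beta> ` A" using \<beta> by simp
    then obtain a where a: "b = \<beta> a" "a \<in> A" by (rule imageE)
    have "stationary {d \<in> E. f d = a}" using a(2) by (simp add: A_def)
    moreover have "{d \<in> E. f d = a} \<subseteq> {d \<in> L. \<pi> d = b}" using a EL by (auto simp: \<pi>_def)
    ultimately show "stationary {d \<in> L. \<pi> d = b}" by (rule stationary_mono) simp
  qed
qed

end

section \<open>Strongly discrete families of ultrafilters\<close>

context regular_uncountable
begin

text \<open>\<open>G\<close> is fixed before \<open>Q\<close> and \<open>\<epsilon>\<close>: each
  \<open>G y\<close> receives a member \<open>g t y\<close> for every \<open>t\<close> in
  \<open>T\<close>, and \<open>Q\<close> and \<open>\<epsilon>\<close> only select the
  \<open>t\<close> to be used. Independence gives finitely many such members a common point.\<close>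

lemma discrete_ultrafilters:
  fixes K :: "'k set"
  assumes K: "K \<noteq> {}" "|K| \<le>o |Pow L|"
  shows "\<exists>G :: 'k set \<Rightarrow> 'a set set.
    (\<forall>y. ultrafilter_on L (G y)) \<and> (\<forall>y. \<forall>x\<in>L. L - {x} \<in> G y) \<and>
    (\<forall>Q (\<epsilon> :: 'k set \<Rightarrow> 'a \<Rightarrow> 'b). Q \<subseteq> Pow K \<longrightarrow> |Q| \<le>o |L| \<longrightarrow> (\<forall>y\<in>Q. inj_on (\<epsilon> y) L) \<longrightarrow>
       (\<exists>g. (\<forall>y\<in>Q. g y \<in> G y) \<and> (\<forall>y\<in>Q. \<forall>z\<in>Q. y \<noteq> z \<longrightarrow> \<epsilon> y ` g y \<inter> \<epsilon> z ` g z = {})))"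
proof -
  obtain \<J> :: "('k set \<Rightarrow> 'a) set" where \<J>: "|\<J>| \<le>o |Pow L|" "\<forall>J\<in>\<J>. range J \<subseteq> L"
    "\<forall>Q. Q \<subseteq> Pow K \<longrightarrow> |Q| \<le>o |L| \<longrightarrow> (\<exists>J\<in>\<J>. inj_on J Q)"
    using separating_functions[OF infinite_L K] by blast
  define T where "T = \<J> \<times> Func L L"
  have "|L| \<le>o |Pow L|" by (rule ordLess_imp_ordLeq[OF card_of_Pow])
  then have "|Func L L| \<le>o |Pow (L \<times> L)|" by (rule Func_Pow_ordLeq)
  moreover have "|L \<times> L| \<le>o |L|"
    by (rule Times_ordLeq[OF infinite_L]) (simp_all add: card_of_refl ordIso_imp_ordLeq)
  then have "|Pow (L \<times> L)| \<le>o |Pow L|" by (rule Pow_mono_ordLeq)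
  ultimately have "|Func L L| \<le>o |Pow L|" by (rule ordLeq_transitive)
  moreover have "infinite (Pow L)" using infinite_L by simp
  ultimately have "|T| \<le>o |Pow L|" unfolding T_def using \<J>(1) by (intro Times_ordLeq)
  \<comment> \<open>Each \<open>t\<close> is named by a subset \<open>c t\<close> of
    \<open>L\<close>, the index of its independent function.\<close>
  then obtain c where c: "inj_on c T" "c ` T \<subseteq> Pow L"
    unfolding card_of_ordLeq[symmetric] by blast
  obtain \<phi> :: "'a set \<Rightarrow> 'a \<Rightarrow> 'a" where \<phi>:
    "\<forall>F v. finite F \<longrightarrow> F \<subseteq> Pow L \<longrightarrow> v ` F \<subseteq> L \<longrightarrow> (\<exists>a\<in>L. \<forall>S\<in>F. \<phi> S a = v S)"
    using independent_functions[OF infinite_L] by blast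
  obtain \<pi> where \<pi>: "\<pi> ` L \<subseteq> L" "\<forall>a\<in>L. stationary {d \<in> L. \<pi> d = a}"
    using stationary_partition by blast
  \<comment> \<open>Composing with \<open>\<pi>\<close> spreads a pattern of values realised at one
    \<open>a\<close> over the whole stationary fibre of \<open>\<pi>\<close> above \<open>a\<close>,
    where a point closed under any given function can be found.\<close>
  define g where "g t y = {d \<in> L. closed_under (snd t) d \<and> fst t y \<lless> d \<and> \<phi> (c t) (\<pi> d) = fst t y}"
    for t :: "('k set \<Rightarrow> 'a) \<times> ('a \<Rightarrow> 'a)" and y
  have "\<exists>G. ultrafilter_on L G \<and> (\<lambda>t. g t y) ` T \<union> (\<lambda>x. L - {x}) ` L \<subseteq> G" for y
  proof -
    have "L \<inter> \<Inter>F \<noteq> {}" if F: "finite F" "F \<subseteq> (\<lambda>t. g t y) ` T \<union> (\<lambda>x. L - {x}) ` L" for F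
    proof -
      have "F \<inter> (\<lambda>t. g t y) ` T \<subseteq> (\<lambda>t. g t y) ` T" "finite (F \<inter> (\<lambda>t. g t y) ` T)"
        using F(1) by auto
      then obtain T0 where T0: "finite T0" "T0 \<subseteq> T" "F \<inter> (\<lambda>t. g t y) ` T = (\<lambda>t. g t y) ` T0"
        using finite_subset_image[of "F \<inter> (\<lambda>t. g t y) ` T"] by metis
      have "F \<inter> (\<lambda>x. L - {x}) ` L \<subseteq> (\<lambda>x. L - {x}) ` L" "finite (F \<inter> (\<lambda>x. L - {x}) ` L)"
        using F(1) by auto
      then obtain X0 where X0: "finite X0" "X0 \<subseteq> L" "F \<inter> (\<lambda>x. L - {x}) ` L = (\<lambda>x. L - {x}) ` X0"
        using finite_subset_image[of "F \<inter> (\<lambda>x. L - {x}) ` L"] by metis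
      have TJ: "fst t y \<in> L" "snd t \<in> Func L L" if "t \<in> T0" for t
      proof -
        have "t \<in> T" using T0(2) that by blast
        then have "fst t \<in> \<J>" "snd t \<in> Func L L" by (auto simp: T_def)
        then show "fst t y \<in> L" "snd t \<in> Func L L" using \<J>(2) by auto
      qed
      define v where "v S = fst (inv_into T0 c S) y" for S
      have cT0: "inj_on c T0" using c(1) T0(2) by (rule inj_on_subset)
      have v: "v (c t) = fst t y" if "t \<in> T0" for t
        using inv_into_f_f[OF cT0 that] by (simp add: v_def)
      have "v ` c ` T0 \<subseteq> L" using v TJ(1) by auto
      moreover have "c ` T0 \<subseteq> Pow L" using c(2) T0(2) by blast
      moreover have "finite (c ` T0)" using T0(1) by simp
      ultimately obtain a where a: "a \<in> L" "\<forall>S\<in>c ` T0. \<phi> S a = v S"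
        using \<phi>[rule_format, of "c ` T0" v] by auto
      \<comment> \<open>A point above \<open>j\<close> is above every \<open>fst t y\<close> and
        differs from all points of \<open>X0\<close>.\<close>
      have "small ((\<lambda>t. fst t y) ` T0 \<union> X0)" using T0(1) X0(1) by (intro small_finite) simp
      moreover have "(\<lambda>t. fst t y) ` T0 \<union> X0 \<subseteq> L" using TJ(1) X0(2) by auto
      ultimately have "\<exists>j\<in>L. \<forall>x\<in>(\<lambda>t. fst t y) ` T0 \<union> X0. x \<lless> j" by (rule small_bounded)
      then obtain j where j: "j \<in> L" "\<forall>x\<in>(\<lambda>t. fst t y) ` T0 \<union> X0. x \<lless> j" by blast
      have "small ((\<lambda>t. snd t x) ` T0)" for x using T0(1) by (intro small_finite) simp
      moreover have "(\<lambda>t. snd t x) ` T0 \<subseteq> L" if "x \<in> L" for x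
        using TJ(2) that by (auto simp: Func_def)
      ultimately have "\<exists>h. h ` L \<subseteq> L \<and> (\<forall>x\<in>L. \<forall>b\<in>(\<lambda>t. snd t x) ` T0. b \<lless> h x)"
        by (rule pointwise_bound)
      then obtain h where h: "h ` L \<subseteq> L" "\<forall>x\<in>L. \<forall>b\<in>(\<lambda>t. snd t x) ` T0. b \<lless> h x" by blast
      have "stationary {d \<in> L. \<pi> d = a}" using \<pi>(2) a(1) by blast
      then obtain d where d: "d \<in> L" "\<pi> d = a" "j \<lless> d" "closed_under h d"
        using h(1) j(1) unfolding stationary_def by blast
      have "d \<in> g t y" if "t \<in> T0" for t
      proof -
        have "closed_under (snd t) d"
          unfolding closed_under_def
        proof (intro allI impI)
          fix x assume x: "x \<lless> d"
          then have "snd t x \<lless> h x" using h(2) that less_in_L(1)[OF x] by simp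
          moreover have "h x \<lless> d" using d(4) x by (simp add: closed_under_def)
          ultimately show "snd t x \<lless> d" by (rule less_trans)
        qed
        moreover have "fst t y \<lless> j" using j(2) that by blast
        then have "fst t y \<lless> d" using d(3) by (rule less_trans)
        moreover have "\<phi> (c t) (\<pi> d) = fst t y" using a(2) that v[OF that] d(2) by simp
        ultimately show ?thesis using d(1) by (simp add: g_def)
      qed
      moreover have "d \<in> L - {x}" if "x \<in> X0" for x
      proof -
        have "x \<lless> j" using j(2) that by blast
        then have "x \<lless> d" using d(3) by (rule less_trans)
        then show ?thesis using d(1) less_irrefl by blast
      qed
      ultimately have "\<forall>S\<in>(\<lambda>t. g t y) ` T0 \<union> (\<lambda>x. L - {x}) ` X0. d \<in> S" by auto
      moreover have "F = F \<inter> ((\<lambda>t. g t y) ` T \<union> (\<lambda>x. L - {x}) ` L)"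
        using F(2) by (simp only: Int_absorb2)
      then have "F = (\<lambda>t. g t y) ` T0 \<union> (\<lambda>x. L - {x}) ` X0"
        by (simp only: Int_Un_distrib T0(3) X0(3))
      ultimately have "d \<in> \<Inter>F" by (simp only: Inter_iff)
      then show ?thesis using d(1) by blast
    qed
    moreover have "(\<lambda>t. g t y) ` T \<union> (\<lambda>x. L - {x}) ` L \<subseteq> Pow L" by (auto simp: g_def)
    ultimately show ?thesis by (intro ultrafilter_exists)
  qed
  then obtain G where G: "\<And>y. ultrafilter_on L (G y)"
    "\<And>y. (\<lambda>t. g t y) ` T \<union> (\<lambda>x. L - {x}) ` L \<subseteq> G y"
    by metis
  show ?thesis
  proof (intro exI[of _ G] conjI allI impI ballI)
    show "ultrafilter_on L (G y)" for y by (rule G(1))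
    show "L - {x} \<in> G y" if "x \<in> L" for x y using G(2)[of y] that by blast
    fix Q and \<epsilon> :: "'k set \<Rightarrow> 'a \<Rightarrow> 'b"
    assume Q: "Q \<subseteq> Pow K" "|Q| \<le>o |L|" and \<epsilon>0: "\<forall>y\<in>Q. inj_on (\<epsilon> y) L"
    then have \<epsilon>: "inj_on (\<epsilon> y) L" if "y \<in> Q" for y using that by blast
    obtain J where J: "J \<in> \<J>" "inj_on J Q" using \<J>(3)[rule_format, OF Q] by blast
    \<comment> \<open>\<open>h\<close> bounds all \<open>b\<close> with \<open>\<epsilon> y a = \<epsilon> z b\<close> for \<open>J y\<close>, \<open>J z\<close>, \<open>a\<close> at most \<open>x\<close>, so a collision with \<open>a < b\<close>
      is impossible when \<open>b\<close> is closed under \<open>h\<close>.\<close>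
    define M where "M x = {b. b \<lless> x \<or> b = x}" for x
    define B where "B x = {b \<in> L. \<exists>y\<in>Q. \<exists>z\<in>Q. \<exists>a\<in>M x. J y \<in> M x \<and> J z \<in> M x \<and> a \<in> L \<and> \<epsilon> y a = \<epsilon> z b}" for x
    have "small (B x)" for x
    proof -
      \<comment> \<open>An element \<open>b\<close> of \<open>B x\<close> is determined by
        \<open>J y\<close>, \<open>J z\<close> and \<open>a\<close>: injectivity of \<open>J\<close>
        on \<open>Q\<close> recovers \<open>y\<close> and \<open>z\<close>, and injectivity of
        \<open>\<epsilon> z\<close> recovers \<open>b\<close>.\<close>
      define f where "f = (\<lambda>((p, q), a). inv_into L (\<epsilon> (inv_into Q J q)) (\<epsilon> (inv_into Q J p) a))"
      have "B x \<subseteq> f ` ((M x \<times> M x) \<times> M x)"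
      proof
        fix b assume "b \<in> B x"
        then obtain y z a where *: "b \<in> L" "y \<in> Q" "z \<in> Q" "a \<in> M x" "J y \<in> M x" "J z \<in> M x"
          "\<epsilon> y a = \<epsilon> z b" unfolding B_def by blast
        have "f ((J y, J z), a) = b"
          using * inv_into_f_f[OF J(2)] inv_into_f_f[OF \<epsilon>] by (simp add: f_def)
        moreover have "((J y, J z), a) \<in> (M x \<times> M x) \<times> M x" using * by simp
        ultimately show "b \<in> f ` ((M x \<times> M x) \<times> M x)" by (metis imageI)
      qed
      moreover have "small (f ` ((M x \<times> M x) \<times> M x))"
        unfolding M_def by (intro small_image small_Times small_atMost)
      ultimately show ?thesis by (rule small_subset[rotated])
    qed
    moreover have "B x \<subseteq> L" for x by (auto simp: B_def)
    ultimately have "\<exists>h. h ` L \<subseteq> L \<and> (\<forall>x\<in>L. \<forall>b\<in>B x. b \<lless> h x)" by (intro pointwise_bound)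
    then obtain h0 where h0: "h0 ` L \<subseteq> L" "\<forall>x\<in>L. \<forall>b\<in>B x. b \<lless> h0 x" by blast
    \<comment> \<open>The value \<open>undefined\<close> off \<open>L\<close> puts \<open>h\<close>
      in \<open>Func L L\<close>, hence \<open>(J, h)\<close> in \<open>T\<close>.\<close>
    define h where "h x = (if x \<in> L then h0 x else undefined)" for x
    have t: "(J, h) \<in> T" using J(1) h0(1) by (auto simp: T_def Func_def h_def)
    have below: "b \<lless> d"
      if d: "closed_under h d" and yz: "y \<in> Q" "z \<in> Q" "J y \<lless> d" "J z \<lless> d"
        and ab: "a \<lless> d" "b \<in> L" "\<epsilon> y a = \<epsilon> z b" for d y z a b
    proof -
      have max: "\<exists>m. m \<lless> d \<and> p \<in> M m \<and> q \<in> M m" if "p \<lless> d" "q \<lless> d" for p q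
        using that less_linear[of p q] less_in_L unfolding M_def by blast
      obtain m where m: "m \<lless> d" "J y \<in> M m" "J z \<in> M m" using max[OF yz(3,4)] by blast
      obtain n where n: "n \<lless> d" "m \<in> M n" "a \<in> M n" using max[OF m(1) ab(1)] by blast
      have "p \<in> M n" if "p \<in> M m" for p using that n(2) by (auto simp: M_def dest: less_trans)
      then have "J y \<in> M n" "J z \<in> M n" using m by blast+
      then have "b \<in> B n" using yz(1,2) ab(2,3) n(3) less_in_L(1)[OF ab(1)] unfolding B_def by blast
      moreover have nL: "n \<in> L" using n(1) less_in_L by blast
      ultimately have "b \<lless> h n" using h0(2) by (simp add: h_def)
      moreover have "h n \<lless> d" using d n(1) by (simp add: closed_under_def)
      ultimately show ?thesis by (rule less_trans)
    qed
    have "g (J, h) y \<in> G y" for y using G(2)[of y] t by blast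
    moreover have "\<epsilon> y ` g (J, h) y \<inter> \<epsilon> z ` g (J, h) z = {}" if yz: "y \<in> Q" "z \<in> Q" "y \<noteq> z" for y z
    proof (rule ccontr)
      assume "\<not> ?thesis"
      then obtain a b where ab: "a \<in> g (J, h) y" "b \<in> g (J, h) z" "\<epsilon> y a = \<epsilon> z b" by auto
      then have a: "a \<in> L" "closed_under h a" "J y \<lless> a" "\<phi> (c (J, h)) (\<pi> a) = J y"
        and b: "b \<in> L" "closed_under h b" "J z \<lless> b" "\<phi> (c (J, h)) (\<pi> b) = J z"
        by (simp_all add: g_def)
      \<comment> \<open>For different indices, \<open>below\<close> makes the larger one less than
        itself. For equal indices, the common value of \<open>\<phi> (c (J, h))\<close> gives
        \<open>J y = J z\<close>, contrary to injectivity on \<open>Q\<close>.\<close>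
      consider "a \<lless> b" | "a = b" | "b \<lless> a" using less_linear[OF a(1) b(1)] by blast
      then show False
      proof cases
        case 1
        then have "b \<lless> b" using below[OF b(2) yz(1,2) _ b(3) 1 b(1) ab(3)] a(3) less_trans by blast
        then show False using less_irrefl by blast
      next
        case 2
        then show False using a(4) b(4) J(2) yz by (simp add: inj_on_def)
      next
        case 3
        then have "a \<lless> a"
          using below[OF a(2) yz(2,1) _ a(3) 3 a(1) ab(3)[symmetric]] b(3) less_trans by blast
        then show False using less_irrefl by blast
      qed
    qed
    ultimately show "\<exists>g. (\<forall>y\<in>Q. g y \<in> G y) \<and>
        (\<forall>y\<in>Q. \<forall>z\<in>Q. y \<noteq> z \<longrightarrow> \<epsilon> y ` g y \<inter> \<epsilon> z ` g z = {})"
      by (intro exI[of _ "g (J, h)"]) blast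
  qed
qed

end

section \<open>The topology of iterated limits\<close>

text \<open>Closure under complement makes the base sets clopen and lets \<open>U\<close> and
  \<open>M - U\<close> separate two points.\<close>

lemma clopen_base_topology:
  assumes sub: "\<And>U. U \<in> \<B> \<Longrightarrow> U \<subseteq> M" and M: "M \<in> \<B>"
    and Int: "\<And>U V. U \<in> \<B> \<Longrightarrow> V \<in> \<B> \<Longrightarrow> U \<inter> V \<in> \<B>"
    and Diff: "\<And>U. U \<in> \<B> \<Longrightarrow> M - U \<in> \<B>"
    and sep: "\<And>x y. x \<in> M \<Longrightarrow> y \<in> M \<Longrightarrow> x \<noteq> y \<Longrightarrow> \<exists>U\<in>\<B>. x \<in> U \<and> y \<notin> U"
  shows "\<exists>X. Hausdorff_space X \<and> clopen_basis X \<B> \<and> topspace X = M"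
proof -
  define X where "X = topology (arbitrary union_of (\<lambda>U. U \<in> \<B>))"
  have "istopology (arbitrary union_of (\<lambda>U. U \<in> \<B>))"
    by (rule istopology_base) (rule Int)
  then have openX: "openin X = arbitrary union_of (\<lambda>U. U \<in> \<B>)"
    unfolding X_def by (rule topology_inverse')
  have open_base: "openin X U" if "U \<in> \<B>" for U
    unfolding openX using that by (rule arbitrary_union_of_inc)
  have top: "topspace X = M"
  proof
    show "M \<subseteq> topspace X" using open_base[OF M] by (rule openin_subset)
    have "(arbitrary union_of (\<lambda>U. U \<in> \<B>)) (topspace X)" unfolding openX[symmetric] by simp
    then obtain \<U> where "\<U> \<subseteq> \<B>" "\<Union>\<U> = topspace X" by (auto simp: union_of_def)
    then show "topspace X \<subseteq> M" using sub by blast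
  qed
  have closed_base: "closedin X U" if "U \<in> \<B>" for U
    using open_base[OF Diff[OF that]] sub[OF that] by (simp add: closedin_def top)
  have "Hausdorff_space X"
    unfolding Hausdorff_space_def top
  proof (intro allI impI)
    fix x y assume xy: "x \<in> M \<and> y \<in> M \<and> x \<noteq> y"
    then obtain U where "U \<in> \<B>" "x \<in> U" "y \<notin> U" using sep by blast
    then show "\<exists>U V. openin X U \<and> openin X V \<and> x \<in> U \<and> y \<in> V \<and> disjnt U V"
      using open_base[of U] open_base[OF Diff, of U] xy
      by (intro exI[of _ U] exI[of _ "M - U"]) (auto simp: disjnt_def)
  qed
  moreover have "clopen_basis X \<B>"
    unfolding clopen_basis_def by (intro conjI ballI open_base closed_base openX)
  ultimately show ?thesis using top by blast
qed

section \<open>Limits along ultrafilters from one level to the next\<close>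

locale limit_system =
  fixes L :: "'a set" and P :: "'p set" and \<epsilon> :: "'p \<Rightarrow> 'a \<Rightarrow> 'p" and G :: "'p \<Rightarrow> 'a set set"
  assumes infinite_index: "infinite L"
    and eps_in: "\<And>y x. y \<in> P \<Longrightarrow> x \<in> L \<Longrightarrow> \<epsilon> y x \<in> P"
    and eps_inj: "\<And>y. y \<in> P \<Longrightarrow> inj_on (\<epsilon> y) L"
    and uf: "\<And>y. y \<in> P \<Longrightarrow> ultrafilter_on L (G y)"
    and nonprincipal: "\<And>y x. y \<in> P \<Longrightarrow> x \<in> L \<Longrightarrow> L - {x} \<in> G y"
    and strongly_discrete: "\<And>Q. Q \<subseteq> P \<Longrightarrow> |Q| \<le>o |L| \<Longrightarrow>
      \<exists>g. (\<forall>y\<in>Q. g y \<in> G y) \<and> (\<forall>y\<in>Q. \<forall>z\<in>Q. y \<noteq> z \<longrightarrow> \<epsilon> y ` g y \<inter> \<epsilon> z ` g z = {})"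
begin

text \<open>If \<open>c\<close> is the trace of a basic clopen set on one level,
  \<open>limits c\<close> is its trace on the next.\<close>

definition limits :: "'p set \<Rightarrow> 'p set" where
  "limits c = {y \<in> P. {x \<in> L. \<epsilon> y x \<in> c} \<in> G y}"

lemma limits_subset: "limits c \<subseteq> P"
  by (auto simp: limits_def)

lemma iter_subset: "c \<subseteq> P \<Longrightarrow> (limits ^^ n) c \<subseteq> P"
  by (cases n) (simp_all add: limits_subset)

lemma limits_Int: "limits (c \<inter> d) = limits c \<inter> limits d"
proof -
  have "{x \<in> L. \<epsilon> y x \<in> c \<inter> d} \<in> G y \<longleftrightarrow> {x \<in> L. \<epsilon> y x \<in> c} \<in> G y \<and> {x \<in> L. \<epsilon> y x \<in> d} \<in> G y"
    if "y \<in> P" for y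
  proof -
    have "{x \<in> L. \<epsilon> y x \<in> c \<inter> d} = {x \<in> L. \<epsilon> y x \<in> c} \<inter> {x \<in> L. \<epsilon> y x \<in> d}" by auto
    then show ?thesis using ultrafilter_Int_iff[OF uf[OF that]] by simp
  qed
  then show ?thesis by (auto simp: limits_def)
qed

lemma limits_Diff: "limits (P - c) = P - limits c"
proof -
  have "{x \<in> L. \<epsilon> y x \<in> P - c} \<in> G y \<longleftrightarrow> {x \<in> L. \<epsilon> y x \<in> c} \<notin> G y" if "y \<in> P" for y
  proof -
    have "{x \<in> L. \<epsilon> y x \<in> P - c} = L - {x \<in> L. \<epsilon> y x \<in> c}" using eps_in[OF that] by auto
    then show ?thesis using ultrafilter_Diff_iff[OF uf[OF that]] by simp
  qed
  then show ?thesis by (auto simp: limits_def)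
qed

lemma iter_Int: "(limits ^^ n) (c \<inter> d) = (limits ^^ n) c \<inter> (limits ^^ n) d"
  by (induction n) (simp_all add: limits_Int)

lemma iter_Diff: "(limits ^^ n) (P - c) = P - (limits ^^ n) c"
  by (induction n) (simp_all add: limits_Diff)

lemma limits_empty: "limits {} = {}"
  using uf by (auto simp: limits_def ultrafilter_on_def)

lemma iter_empty: "(limits ^^ n) {} = {}"
  by (induction n) (simp_all add: limits_empty)

text \<open>An injective \<open>\<epsilon> y\<close> takes the value \<open>z\<close> at most once,
  and \<open>G y\<close> is nonprincipal.\<close>

lemma limits_singleton: "limits {z} = {}"
proof -
  have "{x \<in> L. \<epsilon> y x \<in> {z}} \<notin> G y" if y: "y \<in> P" for y
  proof
    assume G: "{x \<in> L. \<epsilon> y x \<in> {z}} \<in> G y"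
    have "{x \<in> L. \<epsilon> y x \<in> {z}} \<noteq> {}" by (rule ultrafilter_nonempty[OF uf[OF y] G])
    then obtain a where a: "a \<in> L" "\<epsilon> y a = z" by blast
    have "{x \<in> L. \<epsilon> y x \<in> {z}} \<inter> (L - {a}) = {}"
      using a eps_inj[OF y] by (auto simp: inj_on_def)
    moreover have "{x \<in> L. \<epsilon> y x \<in> {z}} \<inter> (L - {a}) \<in> G y"
      by (rule ultrafilter_Int[OF uf[OF y] G nonprincipal[OF y a(1)]])
    ultimately show False using ultrafilter_nonempty[OF uf[OF y]] by blast
  qed
  then show ?thesis by (auto simp: limits_def)
qed

text \<open>The points one level down that decide which members of \<open>Q\<close> lie in
  \<open>limits c\<close>.\<close>

definition support :: "'p set \<Rightarrow> 'p set" where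
  "support Q = (\<Union>y\<in>Q. \<epsilon> y ` L)"

lemma support_subset: "Q \<subseteq> P \<Longrightarrow> support Q \<subseteq> P"
  using eps_in by (auto simp: support_def)

lemma support_ordLeq: "|Q| \<le>o |L| \<Longrightarrow> |support Q| \<le>o |L|"
  unfolding support_def
  by (rule card_of_UNION_ordLeq_infinite[OF infinite_index]) (simp_all add: card_of_image)

lemma limits_cong:
  assumes "c \<inter> support Q = d \<inter> support Q"
  shows "limits c \<inter> Q = limits d \<inter> Q"
proof -
  have "{x \<in> L. \<epsilon> y x \<in> c} = {x \<in> L. \<epsilon> y x \<in> d}" if "y \<in> Q" for y
  proof -
    have "\<epsilon> y x \<in> support Q" if "x \<in> L" for x using that \<open>y \<in> Q\<close> by (auto simp: support_def)
    then show ?thesis using assms by blast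
  qed
  then show ?thesis by (auto simp: limits_def)
qed

text \<open>Passing to the support once per level never exceeds the size \<open>|L|\<close>.\<close>

lemma iter_support:
  assumes "Q \<subseteq> P" "|Q| \<le>o |L|"
  shows "\<exists>Q'. Q' \<subseteq> P \<and> |Q'| \<le>o |L| \<and>
    (\<forall>c d. c \<inter> Q' = d \<inter> Q' \<longrightarrow> (limits ^^ n) c \<inter> Q = (limits ^^ n) d \<inter> Q)"
  using assms
proof (induction n arbitrary: Q)
  case 0
  then show ?case by (intro exI[of _ Q]) simp
next
  case (Suc n)
  obtain Q' where Q': "Q' \<subseteq> P" "|Q'| \<le>o |L|"
    "\<forall>c d. c \<inter> Q' = d \<inter> Q' \<longrightarrow> (limits ^^ n) c \<inter> support Q = (limits ^^ n) d \<inter> support Q"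
    using Suc.IH[OF support_subset[OF Suc.prems(1)] support_ordLeq[OF Suc.prems(2)]] by blast
  have "(limits ^^ Suc n) c \<inter> Q = (limits ^^ Suc n) d \<inter> Q" if "c \<inter> Q' = d \<inter> Q'" for c d
    using limits_cong[OF Q'(3)[rule_format, OF that]] by simp
  with Q'(1,2) show ?case by blast
qed

text \<open>\<open>d\<close> is the union of the disjoint sets that strong discreteness attaches to
  the points of \<open>c\<close>. The sets attached to other points of \<open>Q\<close> miss
  \<open>d\<close> and keep those points out of \<open>limits d\<close>.\<close>

lemma limits_realise:
  assumes Q: "Q \<subseteq> P" "|Q| \<le>o |L|" and c: "c \<subseteq> Q"
  shows "\<exists>d\<subseteq>P. limits d \<inter> Q = c"
proof -
  obtain g where "(\<forall>y\<in>Q. g y \<in> G y) \<and> (\<forall>y\<in>Q. \<forall>z\<in>Q. y \<noteq> z \<longrightarrow> \<epsilon> y ` g y \<inter> \<epsilon> z ` g z = {})"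
    using strongly_discrete[OF Q] by (rule exE)
  then have g: "\<And>y. y \<in> Q \<Longrightarrow> g y \<in> G y"
    "\<And>y z. y \<in> Q \<Longrightarrow> z \<in> Q \<Longrightarrow> y \<noteq> z \<Longrightarrow> \<epsilon> y ` g y \<inter> \<epsilon> z ` g z = {}"
    by simp_all
  define d where "d = (\<Union>y\<in>c. \<epsilon> y ` g y)"
  have gL: "g y \<subseteq> L" if "y \<in> Q" for y
    using ultrafilter_subset[OF uf, of y "g y"] g(1) Q(1) that by blast
  have "d \<subseteq> P" using gL c Q(1) eps_in unfolding d_def by blast
  moreover have "y \<in> limits d \<longleftrightarrow> y \<in> c" if y: "y \<in> Q" for y
  proof
    assume "y \<in> c"
    then have "g y \<subseteq> {x \<in> L. \<epsilon> y x \<in> d}" using gL[OF y] by (auto simp: d_def)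
    moreover have "g y \<in> G y" using g(1) y by blast
    ultimately have "{x \<in> L. \<epsilon> y x \<in> d} \<in> G y"
      using ultrafilter_mono[OF uf, of y "g y"] y Q(1) by blast
    then show "y \<in> limits d" using y Q(1) by (auto simp: limits_def)
  next
    assume lim: "y \<in> limits d"
    show "y \<in> c"
    proof (rule ccontr)
      assume "y \<notin> c"
      then have "\<epsilon> y ` g y \<inter> d = {}" using g(2) y c unfolding d_def by blast
      then have "{x \<in> L. \<epsilon> y x \<in> d} \<inter> g y = {}" by blast
      moreover have "{x \<in> L. \<epsilon> y x \<in> d} \<inter> g y \<in> G y"
        using ultrafilter_Int[OF uf, of y "{x \<in> L. \<epsilon> y x \<in> d}" "g y"] lim g(1) y
        by (simp add: limits_def)
      ultimately show False using ultrafilter_nonempty[OF uf, of y] y Q(1) by blast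
    qed
  qed
  ultimately show ?thesis using c by blast
qed

text \<open>The trace \<open>c\<close> is realised by some \<open>e\<close> one level down, of which
  only the part on the support of \<open>Q\<close> has to be realised further.\<close>

lemma iter_realise:
  assumes "Q \<subseteq> P" "|Q| \<le>o |L|" "c \<subseteq> Q"
  shows "\<exists>d\<subseteq>P. (limits ^^ n) d \<inter> Q = c"
  using assms
proof (induction n arbitrary: Q c)
  case 0
  then have "c \<subseteq> P \<and> (limits ^^ 0) c \<inter> Q = c" by auto
  then show ?case by blast
next
  case (Suc n)
  obtain e where e: "limits e \<inter> Q = c" using limits_realise[OF Suc.prems] by blast
  obtain d where d: "d \<subseteq> P" "(limits ^^ n) d \<inter> support Q = e \<inter> support Q"
    using Suc.IH[OF support_subset[OF Suc.prems(1)] support_ordLeq[OF Suc.prems(2)], of "e \<inter> support Q"]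
    by blast
  have "(limits ^^ Suc n) d \<inter> Q = c" using limits_cong[OF d(2)] e by simp
  with d(1) show ?case by blast
qed

text \<open>The clopen set with trace \<open>c\<close> on level \<open>0\<close>.\<close>
definition box :: "'p set \<Rightarrow> (nat \<times> 'p) set" where
  "box c = (SIGMA n:UNIV. (limits ^^ n) c)"

text \<open>At most \<open>|L|\<close> points of level \<open>n\<close> decide whether a basic set
  contains \<open>z\<close> on level \<open>n + k\<close>. If among these and \<open>y\<close> its
  trace contains only \<open>y\<close>, then \<open>z\<close> is treated as if the trace were
  \<open>{y}\<close>, whose \<open>k\<close>-th iterate misses \<open>z\<close>.\<close>

lemma separation_aux:
  assumes y: "y \<in> P" and z: "z \<in> P" and k: "k \<noteq> 0 \<or> y \<noteq> z"
  shows "\<exists>c\<subseteq>P. y \<in> (limits ^^ n) c \<and> z \<notin> (limits ^^ (n + k)) c"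
proof -
  have "|{z}| \<le>o |L|" by (rule card_of_singl_ordLeq) (use infinite_index in auto)
  then obtain Q where Q: "Q \<subseteq> P" "|Q| \<le>o |L|"
    "\<forall>c d. c \<inter> Q = d \<inter> Q \<longrightarrow> (limits ^^ k) c \<inter> {z} = (limits ^^ k) d \<inter> {z}"
    using iter_support[of "{z}" k] z by blast
  have "|insert y Q| \<le>o |L|" by (rule insert_ordLeq[OF infinite_index Q(2)])
  moreover have "insert y Q \<subseteq> P" using y Q(1) by blast
  ultimately obtain c where c: "c \<subseteq> P" "(limits ^^ n) c \<inter> insert y Q = {y}"
    using iter_realise[of "insert y Q" "{y}" n] by blast
  then have "(limits ^^ n) c \<inter> Q = {y} \<inter> Q" by blast
  then have "(limits ^^ k) ((limits ^^ n) c) \<inter> {z} = (limits ^^ k) {y} \<inter> {z}"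
    using Q(3) by blast
  moreover have "z \<notin> (limits ^^ k) {y}"
  proof (cases k)
    case 0
    then show ?thesis using k by simp
  next
    case (Suc m)
    then have "(limits ^^ k) {y} = (limits ^^ m) (limits {y})" by (simp only: funpow_Suc_right o_apply)
    then show ?thesis by (simp add: limits_singleton iter_empty)
  qed
  moreover have "(limits ^^ (n + k)) c = (limits ^^ k) ((limits ^^ n) c)"
    by (simp only: add.commute[of n k] funpow_add o_apply)
  ultimately have "z \<notin> (limits ^^ (n + k)) c" by blast
  moreover have "y \<in> (limits ^^ n) c" using c(2) by blast
  ultimately show ?thesis using c(1) by blast
qed

lemma separation:
  assumes "y \<in> P" "z \<in> P" "(n, y) \<noteq> (m, z)"
  shows "\<exists>c\<subseteq>P. (n, y) \<in> box c \<and> (m, z) \<notin> box c"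
proof (cases "n \<le> m")
  case True
  then obtain k where k: "m = n + k" using le_Suc_ex by blast
  then have "k \<noteq> 0 \<or> y \<noteq> z" using assms(3) by auto
  then show ?thesis using separation_aux[OF assms(1,2), of k n] k by (simp add: box_def)
next
  case False
  \<comment> \<open>\<open>separation_aux\<close> places the point of the lower level inside the
    set, so here the roles are exchanged and a complement is taken.\<close>
  then obtain k where k: "n = m + k" "k \<noteq> 0" using le_Suc_ex[of m n] by force
  then obtain c where c: "c \<subseteq> P" "z \<in> (limits ^^ m) c" "y \<notin> (limits ^^ n) c"
    using separation_aux[OF assms(2,1), of k m] by blast
  then have "(n, y) \<in> box (P - c)" "(m, z) \<notin> box (P - c)"
    using assms(1) by (simp_all add: box_def iter_Diff)
  then show ?thesis by blast
qed

text \<open>The boxes form a Boolean algebra because the iterates of \<open>limits\<close> commute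
  with intersection and complement; \<open>\<beta>\<close> carries them to the prescribed carrier
  \<open>M\<close>.\<close>

lemma limit_topology:
  assumes \<beta>: "bij_betw \<beta> (UNIV \<times> P) M"
  shows "\<exists>X. Hausdorff_space X \<and> clopen_basis X ((\<lambda>c. \<beta> ` box c) ` Pow P) \<and> topspace X = M"
proof (rule clopen_base_topology)
  have inj: "inj_on \<beta> (UNIV \<times> P)" and M: "\<beta> ` (UNIV \<times> P) = M"
    using \<beta> by (simp_all add: bij_betw_def)
  have sub: "box c \<subseteq> UNIV \<times> P" if "c \<subseteq> P" for c
    using iter_subset[OF that] by (auto simp: box_def)
  show "U \<subseteq> M" if "U \<in> (\<lambda>c. \<beta> ` box c) ` Pow P" for U
  proof -
    obtain c where "c \<subseteq> P" "U = \<beta> ` box c" using \<open>U \<in> (\<lambda>c. \<beta> ` box c) ` Pow P\<close> by blast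
    then show ?thesis using image_mono[OF sub, of c \<beta>] by (simp add: M)
  qed
  have "(limits ^^ n) P = P" for n using iter_Diff[of n "{}"] iter_empty by simp
  then have "box P = UNIV \<times> P" by (simp add: box_def)
  then show "M \<in> (\<lambda>c. \<beta> ` box c) ` Pow P" by (intro image_eqI[of _ _ P]) (simp_all add: M)
  show "U \<inter> V \<in> (\<lambda>c. \<beta> ` box c) ` Pow P"
    if UV: "U \<in> (\<lambda>c. \<beta> ` box c) ` Pow P" "V \<in> (\<lambda>c. \<beta> ` box c) ` Pow P" for U V
  proof -
    obtain c where c: "c \<subseteq> P" "U = \<beta> ` box c" using UV(1) by blast
    obtain d where d: "d \<subseteq> P" "V = \<beta> ` box d" using UV(2) by blast
    have "box (c \<inter> d) = box c \<inter> box d" by (auto simp: box_def iter_Int)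
    then have "U \<inter> V = \<beta> ` box (c \<inter> d)"
      using inj_on_image_Int[OF inj sub[OF c(1)] sub[OF d(1)]] c(2) d(2) by simp
    then show ?thesis using c(1) by blast
  qed
  show "M - U \<in> (\<lambda>c. \<beta> ` box c) ` Pow P" if U: "U \<in> (\<lambda>c. \<beta> ` box c) ` Pow P" for U
  proof -
    obtain c where c: "c \<subseteq> P" "U = \<beta> ` box c" using U by blast
    have "box (P - c) = UNIV \<times> P - box c" by (auto simp: box_def iter_Diff)
    then have "M - U = \<beta> ` box (P - c)"
      using inj_on_image_set_diff[OF inj, of "UNIV \<times> P" "box c"] sub[OF c(1)] c(2)
      by (simp add: M Diff_subset)
    then show ?thesis by blast
  qed
  show "\<exists>U\<in>(\<lambda>c. \<beta> ` box c) ` Pow P. p \<in> U \<and> q \<notin> U" if pq: "p \<in> M" "q \<in> M" "p \<noteq> q" for p q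
  proof -
    have "p \<in> \<beta> ` (UNIV \<times> P)" "q \<in> \<beta> ` (UNIV \<times> P)" using pq M by simp_all
    then obtain n y m z where ny: "y \<in> P" "p = \<beta> (n, y)" and mz: "z \<in> P" "q = \<beta> (m, z)" by blast
    then have "(n, y) \<noteq> (m, z)" using pq(3) by blast
    then obtain c where c: "c \<subseteq> P" "(n, y) \<in> box c" "(m, z) \<notin> box c"
      using separation[OF ny(1) mz(1)] by blast
    have "p \<in> \<beta> ` box c" using c(2) ny(2) by blast
    moreover have "q \<notin> \<beta> ` box c"
      using inj_on_image_mem_iff[OF inj _ sub[OF c(1)], of "(m, z)"] c(3) mz by simp
    ultimately show ?thesis using c(1) by blast
  qed
qed

text \<open>A box around \<open>(Suc n, y)\<close> contains \<open>(n, \<epsilon> y x)\<close> for a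
  set of \<open>x\<close> that belongs to \<open>G y\<close>, hence for at least one
  \<open>x\<close>; so no basic neighbourhood avoids \<open>Y\<close>.\<close>

lemma closed_limit:
  assumes \<beta>: "bij_betw \<beta> (UNIV \<times> P) (topspace X)"
    and X: "clopen_basis X ((\<lambda>c. \<beta> ` box c) ` Pow P)" "closedin X Y"
    and y: "y \<in> P" "\<And>x. x \<in> L \<Longrightarrow> \<beta> (n, \<epsilon> y x) \<in> Y"
  shows "\<beta> (Suc n, y) \<in> Y"
proof (rule ccontr)
  assume "\<beta> (Suc n, y) \<notin> Y"
  moreover have "\<beta> (Suc n, y) \<in> topspace X" using bij_betw_apply[OF \<beta>, of "(Suc n, y)"] y(1) by simp
  ultimately have out: "\<beta> (Suc n, y) \<in> topspace X - Y" by simp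
  have "openin X (topspace X - Y)" using X(2) by (simp add: closedin_def)
  then have "(arbitrary union_of (\<lambda>U. U \<in> (\<lambda>c. \<beta> ` box c) ` Pow P)) (topspace X - Y)"
    using X(1) by (simp add: clopen_basis_def)
  then obtain \<U> where \<U>: "\<U> \<subseteq> (\<lambda>c. \<beta> ` box c) ` Pow P" "\<Union>\<U> = topspace X - Y"
    by (auto simp: union_of_def)
  from out have "\<beta> (Suc n, y) \<in> \<Union>\<U>" by (simp only: \<U>(2))
  then obtain U where U: "U \<in> \<U>" "\<beta> (Suc n, y) \<in> U" by (rule UnionE)
  have "U \<subseteq> topspace X - Y" using Union_upper[OF U(1)] by (simp only: \<U>(2))
  moreover obtain c where "c \<in> Pow P" "U = \<beta> ` box c" using subsetD[OF \<U>(1) U(1)] by (rule imageE) simp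
  ultimately have c: "c \<subseteq> P" "\<beta> (Suc n, y) \<in> \<beta> ` box c" "\<beta> ` box c \<subseteq> topspace X - Y"
    using U(2) by simp_all
  have inj: "inj_on \<beta> (UNIV \<times> P)" using \<beta> by (simp add: bij_betw_def)
  have "box c \<subseteq> UNIV \<times> P" using iter_subset[OF c(1)] by (auto simp: box_def)
  then have "(Suc n, y) \<in> box c"
    using inj_on_image_mem_iff[OF inj, of "(Suc n, y)" "box c"] c(2) y(1) by simp
  then have "{x \<in> L. \<epsilon> y x \<in> (limits ^^ n) c} \<in> G y"
    by (simp add: box_def limits_def)
  then have "{x \<in> L. \<epsilon> y x \<in> (limits ^^ n) c} \<noteq> {}"
    by (rule ultrafilter_nonempty[OF uf[OF y(1)]])
  then obtain x where x: "x \<in> L" "(n, \<epsilon> y x) \<in> box c" by (auto simp: box_def)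
  then have "\<beta> (n, \<epsilon> y x) \<in> topspace X - Y" using c(3) by blast
  then show False using y(2)[OF x(1)] by blast
qed

end

section \<open>Spaces without closed sets of intermediate size\<close>

text \<open>\<open>P\<close> is mapped onto \<open>E \<times> P\<close>, where \<open>E\<close> is
  the set of injections. The first coordinate lists \<open>E\<close>; the second maps the places of
  each \<open>e\<close> onto \<open>P\<close>, so there are at least \<open>|P|\<close> of
  them.\<close>

lemma enumerate_injections:
  fixes L :: "'a set" and P :: "'p set"
  assumes P: "infinite P" "|L| \<le>o |P|" "|Func L P| \<le>o |P|"
  shows "\<exists>\<epsilon> :: 'p \<Rightarrow> 'a \<Rightarrow> 'p. (\<forall>y\<in>P. \<epsilon> y \<in> Func L P \<and> inj_on (\<epsilon> y) L) \<and>
    (\<forall>e\<in>Func L P. inj_on e L \<longrightarrow> |P| \<le>o |{y \<in> P. \<epsilon> y = e}| )"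
proof -
  define E where "E = {e \<in> Func L P. inj_on e L}"
  obtain f where f: "inj_on f L" "f ` L \<subseteq> P"
    using P(2) unfolding card_of_ordLeq[symmetric] by blast
  \<comment> \<open>This member of \<open>Func L P\<close> shows that \<open>E\<close> is nonempty,
    as a surjection onto \<open>E \<times> P\<close> requires.\<close>
  define f' where "f' x = (if x \<in> L then f x else undefined)" for x
  have "f' \<in> E" using f by (auto simp: E_def Func_def f'_def inj_on_def)
  moreover obtain p where "p \<in> P" using P(1) by fastforce
  ultimately have "E \<times> P \<noteq> {}" by blast
  have "E \<subseteq> Func L P" by (auto simp: E_def)
  then have "|E| \<le>o |P|" by (rule ordLeq_transitive[OF card_of_mono1 P(3)])
  then have "|E \<times> P| \<le>o |P|" by (rule Times_ordLeq[OF P(1) _ card_of_mono1[OF order_refl]])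
  then obtain \<sigma> where \<sigma>: "\<sigma> ` P = E \<times> P" using \<open>E \<times> P \<noteq> {}\<close> by (rule card_of_ordLeq_surj)
  have "fst (\<sigma> y) \<in> E" if "y \<in> P" for y
  proof -
    have "\<sigma> y \<in> E \<times> P" using imageI[OF that, of \<sigma>] by (simp only: \<sigma>)
    then show ?thesis by (simp add: mem_Times_iff)
  qed
  moreover have "|P| \<le>o |{y \<in> P. fst (\<sigma> y) = e}|" if e: "e \<in> E" for e
  proof (rule surj_imp_ordLeq)
    show "P \<subseteq> (\<lambda>y. snd (\<sigma> y)) ` {y \<in> P. fst (\<sigma> y) = e}"
    proof
      fix p assume "p \<in> P"
      then have "(e, p) \<in> \<sigma> ` P" using e by (simp add: \<sigma>)
      then obtain y where "(e, p) = \<sigma> y" "y \<in> P" by (rule imageE)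
      then show "p \<in> (\<lambda>y. snd (\<sigma> y)) ` {y \<in> P. fst (\<sigma> y) = e}"
        by (intro image_eqI[of _ _ y]) (auto dest: sym)
    qed
  qed
  ultimately show ?thesis by (intro exI[of _ "\<lambda>y. fst (\<sigma> y)"]) (simp add: E_def)
qed

section \<open>Large closed sets in the space of iterated limits\<close>

context regular_uncountable
begin

text \<open>Otherwise \<open>Y\<close> would be a countable union of small sets, and
  \<open>lam\<close> is regular and uncountable.\<close>

lemma large_level:
  assumes "\<not> small Y" "Y \<subseteq> (UNIV :: nat set) \<times> P"
  shows "\<exists>n. |L| \<le>o |{y \<in> P. (n, y) \<in> Y}|"
proof (rule ccontr)
  assume "\<not> ?thesis"
  then have "small {y \<in> P. (n, y) \<in> Y}" for n using not_small by blast
  then have "small (Pair n ` {y \<in> P. (n, y) \<in> Y})" for n by (rule small_image)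
  moreover have "small (UNIV :: nat set)" by (rule small_countable) simp
  ultimately have "small (\<Union>n. Pair n ` {y \<in> P. (n, y) \<in> Y})" by (intro small_UN)
  then have "small Y" by (rule small_subset) (use assms(2) in auto)
  with assms(1) show False by blast
qed

text \<open>The lower bound on \<open>K\<close> makes \<open>Func L (Pow K)\<close> no larger than
  \<open>Pow K\<close>, so that points can enumerate the injections; the upper bound is what
  \<open>discrete_ultrafilters\<close> asks for.\<close>

lemma space_with_large_closed_sets:
  fixes K :: "'k set"
  assumes K: "|L| \<le>o |K|" "|K| \<le>o |Pow L|"
  shows "\<exists>X :: 'k set topology. Hausdorff_space X \<and> (\<exists>\<B>. clopen_basis X \<B>) \<and> topspace X = Pow K \<and>
    (\<forall>Y. closedin X Y \<longrightarrow> \<not> small Y \<longrightarrow> |Pow K| \<le>o |Y| )"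
proof -
  let ?P = "Pow K"
  have infK: "infinite K" using card_of_ordLeq_infinite[OF K(1) infinite_L] .
  then have infP: "infinite ?P" by simp
  have KP: "|K| \<le>o |?P|" by (rule ordLess_imp_ordLeq[OF card_of_Pow])
  have LP: "|L| \<le>o |?P|" by (rule ordLeq_transitive[OF K(1) KP])
  have "|L \<times> K| \<le>o |K|" by (rule Times_ordLeq[OF infK K(1) card_of_mono1[OF order_refl]])
  then have "|Pow (L \<times> K)| \<le>o |?P|" by (rule Pow_mono_ordLeq)
  then have FP: "|Func L ?P| \<le>o |?P|"
    by (rule ordLeq_transitive[OF Func_Pow_ordLeq[OF card_of_mono1[OF order_refl]]])
  obtain \<epsilon> :: "'k set \<Rightarrow> 'a \<Rightarrow> 'k set" where
    \<epsilon>: "\<forall>y\<in>?P. \<epsilon> y \<in> Func L ?P \<and> inj_on (\<epsilon> y) L"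
       "\<forall>e\<in>Func L ?P. inj_on e L \<longrightarrow> |?P| \<le>o |{y \<in> ?P. \<epsilon> y = e}|"
    using enumerate_injections[OF infP LP FP] by (elim exE conjE)
  have neK: "K \<noteq> {}" using infK by auto
  obtain G :: "'k set \<Rightarrow> 'a set set" where G: "\<forall>y. ultrafilter_on L (G y)"
    "\<forall>y. \<forall>x\<in>L. L - {x} \<in> G y"
    "\<forall>Q (\<epsilon> :: 'k set \<Rightarrow> 'a \<Rightarrow> 'k set). Q \<subseteq> ?P \<longrightarrow> |Q| \<le>o |L| \<longrightarrow> (\<forall>y\<in>Q. inj_on (\<epsilon> y) L) \<longrightarrow>
       (\<exists>g. (\<forall>y\<in>Q. g y \<in> G y) \<and> (\<forall>y\<in>Q. \<forall>z\<in>Q. y \<noteq> z \<longrightarrow> \<epsilon> y ` g y \<inter> \<epsilon> z ` g z = {}))"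
    using discrete_ultrafilters[OF neK K(2)] by (elim exE conjE)
  interpret limit_system L ?P \<epsilon> G
  proof
    show "infinite L" by (rule infinite_L)
    show "\<epsilon> y x \<in> ?P" if "y \<in> ?P" "x \<in> L" for y x
    proof -
      have "\<epsilon> y \<in> Func L ?P" by (rule conjunct1[OF bspec[OF \<epsilon>(1) that(1)]])
      then show ?thesis using that(2) by (simp add: Func_def)
    qed
    show "inj_on (\<epsilon> y) L" if "y \<in> ?P" for y by (rule conjunct2[OF bspec[OF \<epsilon>(1) that]])
    show "ultrafilter_on L (G y)" for y using G(1) by (rule spec)
    show "L - {x} \<in> G y" if "x \<in> L" for y x using G(2)[rule_format, OF that] .
    show "\<exists>g. (\<forall>y\<in>Q. g y \<in> G y) \<and> (\<forall>y\<in>Q. \<forall>z\<in>Q. y \<noteq> z \<longrightarrow> \<epsilon> y ` g y \<inter> \<epsilon> z ` g z = {})"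
      if Q: "Q \<subseteq> ?P" "|Q| \<le>o |L|" for Q
    proof (rule G(3)[rule_format, OF Q])
      show "inj_on (\<epsilon> y) L" if "y \<in> Q" for y
        by (rule conjunct2[OF bspec[OF \<epsilon>(1) subsetD[OF Q(1) that]]])
    qed
  qed
  have "|UNIV :: nat set| \<le>o |?P|" using infP infinite_iff_card_of_nat[of ?P] by simp
  then have "|(UNIV :: nat set) \<times> ?P| \<le>o |?P|"
    by (rule Times_ordLeq[OF infP _ card_of_mono1[OF order_refl]])
  moreover have "|?P| \<le>o |(UNIV :: nat set) \<times> ?P|" by (rule card_of_Times2) simp
  ultimately have "|(UNIV :: nat set) \<times> ?P| =o |?P|" by (simp add: ordIso_iff_ordLeq)
  \<comment> \<open>All levels together are no larger than one, so the space can live on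
    \<open>Pow K\<close> itself.\<close>
  then obtain \<beta> :: "nat \<times> 'k set \<Rightarrow> 'k set" where \<beta>: "bij_betw \<beta> (UNIV \<times> ?P) ?P"
    unfolding card_of_ordIso[symmetric] by (rule exE)
  obtain X where X: "Hausdorff_space X" "clopen_basis X ((\<lambda>c. \<beta> ` box c) ` Pow ?P)" "topspace X = ?P"
    using limit_topology[OF \<beta>] by (elim exE conjE)
  have inj: "inj_on \<beta> (UNIV \<times> ?P)" using \<beta> by (simp add: bij_betw_def)
  have "|?P| \<le>o |Y|" if Y: "closedin X Y" "\<not> small Y" for Y
  proof -
    define Z where "Z = {p \<in> UNIV \<times> ?P. \<beta> p \<in> Y}"
    have "Y \<subseteq> \<beta> ` (UNIV \<times> ?P)"
      using closedin_subset[OF Y(1)] \<beta> X(3) by (simp add: bij_betw_def)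
    then have "Y \<subseteq> \<beta> ` Z" by (auto simp: Z_def)
    then have "\<not> small Z" using Y(2) small_subset[OF small_image[of Z \<beta>]] by blast
    moreover have "Z \<subseteq> UNIV \<times> ?P" by (auto simp: Z_def)
    ultimately obtain n where "|L| \<le>o |{y \<in> ?P. (n, y) \<in> Z}|"
      using large_level[of Z ?P] by blast
    \<comment> \<open>An injection \<open>e\<close> lists \<open>|L|\<close> points of
      \<open>Y\<close> on level \<open>n\<close>; each \<open>y\<close> with
      \<open>\<epsilon> y = e\<close> then gives a point of \<open>Y\<close> on level
      \<open>Suc n\<close>.\<close>
    then obtain f where f: "inj_on f L" "f ` L \<subseteq> {y \<in> ?P. (n, y) \<in> Z}"
      unfolding card_of_ordLeq[symmetric] by blast
    define e where "e x = (if x \<in> L then f x else undefined)" for x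
    have fe: "e x = f x" if "x \<in> L" for x using that by (simp add: e_def)
    have e: "e \<in> Func L ?P" "inj_on e L"
      using f by (auto simp: Func_def e_def inj_on_def)
    have eZ: "\<beta> (n, e x) \<in> Y" if "x \<in> L" for x
      using imageI[OF that, of f] f(2) fe[OF that] by (auto simp: Z_def)
    have "\<beta> (Suc n, y) \<in> Y" if "y \<in> {y \<in> ?P. \<epsilon> y = e}" for y
    proof (rule closed_limit[OF _ X(2) Y(1)])
      show "bij_betw \<beta> (UNIV \<times> ?P) (topspace X)" using \<beta> by (simp add: X(3))
      show "y \<in> ?P" using that by simp
      show "\<beta> (n, \<epsilon> y x) \<in> Y" if "x \<in> L" for x using eZ[OF that] \<open>y \<in> {y \<in> ?P. \<epsilon> y = e}\<close> by simp
    qed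
    then have "(\<lambda>y. \<beta> (Suc n, y)) ` {y \<in> ?P. \<epsilon> y = e} \<subseteq> Y" by (rule image_subsetI)
    moreover have "inj_on (\<lambda>y. \<beta> (Suc n, y)) {y \<in> ?P. \<epsilon> y = e}"
      using inj by (auto simp: inj_on_def)
    ultimately have "|{y \<in> ?P. \<epsilon> y = e}| \<le>o |Y|"
      unfolding card_of_ordLeq[symmetric] by blast
    moreover have "|?P| \<le>o |{y \<in> ?P. \<epsilon> y = e}|" using \<epsilon>(2) e by simp
    ultimately show ?thesis by (rule ordLeq_transitive[rotated])
  qed
  then show ?thesis using X by (intro exI[of _ X]) blast
qed

end

section \<open>Locating \<open>\<kappa>\<close> between \<open>lam\<close> and
  \<open>ctwo ^c lam\<close>\<close>

theorem theorem1p1: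
  fixes lam :: "'a rel" and \<mu> :: "'m rel" and \<kappa> :: "'k rel"
  assumes "Card_order lam" and "regularCard lam" and "natLeq <o lam"
    and "Card_order \<mu>" and "\<mu> =o ctwo ^c lam"
    and "least_exp_above \<mu> \<kappa>"
  shows "\<exists>X :: 'k set topology.
    Hausdorff_space X \<and>
    (\<exists>\<B>. clopen_basis X \<B>) \<and>
    |topspace X| =o ctwo ^c \<kappa> \<and>
    (\<forall>Y. closedin X Y \<and> |Y| <o |topspace X| \<longrightarrow> |Y| <o lam)"
proof -
  interpret regular_uncountable lam using assms(1-3) by unfold_locales
  let ?K = "Field \<kappa>"
  have \<kappa>: "Card_order \<kappa>" "\<mu> <o ctwo ^c \<kappa>" using assms(6) by (simp_all add: least_exp_above_def)
  have ctwo: "|Pow (Field r)| =o ctwo ^c r" for r :: "'x rel"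
    unfolding cexp_def ctwo_def Field_card_of by (rule card_of_Pow_Func)
  have \<mu>_Pow: "\<mu> =o |Pow L|"
    by (rule ordIso_transitive[OF assms(5) ordIso_symmetric[OF ctwo]])
  \<comment> \<open>If \<open>\<kappa>\<close> were below \<open>lam\<close>, its power would be at
    most that of \<open>lam\<close>, which is \<open>\<mu>\<close>.\<close>
  have "|L| \<le>o |?K|"
  proof (rule ccontr)
    assume "\<not> |L| \<le>o |?K|"
    then have "|?K| \<le>o |L|" using ordLeq_total[OF card_of_Well_order card_of_Well_order] by blast
    then have "|Pow ?K| \<le>o |Pow L|" by (rule Pow_mono_ordLeq)
    then have "ctwo ^c \<kappa> \<le>o |Pow L|" by (rule ordIso_ordLeq_trans[OF ordIso_symmetric[OF ctwo]])
    then have "ctwo ^c \<kappa> \<le>o \<mu>" by (rule ordLeq_ordIso_trans[OF _ ordIso_symmetric[OF \<mu>_Pow]])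
    then show False using \<kappa>(2) not_ordLess_ordLeq by blast
  qed
  moreover have "|?K| \<le>o |Pow L|"
  proof -
    \<comment> \<open>By Cantor's theorem \<open>\<mu>\<close> is itself a candidate for the
      minimum.\<close>
    have "\<kappa> \<le>o \<mu>"
      by (rule least_exp_above_minimal[OF assms(6,4) ordLess_ctwo_cexp[OF assms(4)]])
    then have "\<kappa> \<le>o |Pow L|" by (rule ordLeq_ordIso_trans[OF _ \<mu>_Pow])
    then show ?thesis by (rule ordIso_ordLeq_trans[OF card_of_Field_ordIso[OF \<kappa>(1)]])
  qed
  ultimately obtain X :: "'k set topology" where X: "Hausdorff_space X" "\<exists>\<B>. clopen_basis X \<B>"
    "topspace X = Pow ?K" "\<forall>Y. closedin X Y \<longrightarrow> \<not> small Y \<longrightarrow> |Pow ?K| \<le>o |Y|"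
    using space_with_large_closed_sets[of ?K] by blast
  have "|Y| <o lam" if Y: "closedin X Y" "|Y| <o |topspace X|" for Y
  proof (rule ccontr)
    assume "\<not> |Y| <o lam"
    then have "|topspace X| \<le>o |Y|" using X(4) Y(1) by (simp add: small_def X(3))
    then show False using Y(2) not_ordLess_ordLeq by blast
  qed
  moreover have "|topspace X| =o ctwo ^c \<kappa>" using ctwo by (simp add: X(3))
  ultimately show ?thesis using X(1,2) by (intro exI[of _ X]) simp
qed

end
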